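(* Let $r_1, r_2, d \in \mathbb{N}$ satisfy $r_1 \geq d \geq 2$ and let $A, B$ be finite, non-empty subsets of $\mathbb{R}^d$ such that $|A| \geq |B|$ and $\dim(A+B) = d$. Let $v \in \mathbb{R}^d \setminus \{0\}$ satisfy $|\pi_v(A)| = r_1$ and $|\pi_v(B)| = r_2$. Then \[ |A+B| \geq |A| + \left(d + 1 - \frac{1}{r_1 - d + 2} - \frac{1}{r_2 - c + 2}\right)|B| - (d-1)(r_1 + r_2), \] where $c = d$ if $r_2 \geq d$, and $c = \dim(B)$ if $r_2 < d$.
   Context: For finite sets $A, B \subseteq \mathbb{R}^d$, $A + B = \{a+b : a \in A,\ b \in B\}$. For a non-empty set $A \subseteq \mathbb{R}^d$, $\dim(A)$ denotes the dimension of the affine subspace spanned by $A$. For $v \in \mathbb{R}^d \setminus \{0\}$, $H_v$ is the hyperplane through the origin orthogonal to $v$ and $\pi_v : \mathbb{R}^d \to H_v$ is the orthogonal projection. $\mathbb{N}$ denotes the positive integers. *)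

theory Defs
  imports "HOL-Analysis.Analysis"
begin

definition orth_hyperplane :: "'a::real_inner \<Rightarrow> 'a set" where
  "orth_hyperplane v = {x. v \<bullet> x = 0}"

(* Meaningful for v \<noteq> 0 only. *)
definition orth_proj :: "'a::real_inner \<Rightarrow> 'a \<Rightarrow> 'a" where
  "orth_proj v x = x - ((v \<bullet> x) / (v \<bullet> v)) *\<^sub>R v"

lemma orth_proj_iff:
  assumes "v \<noteq> 0"
  shows "orth_proj v x = y \<longleftrightarrow>
    y \<in> orth_hyperplane v \<and> (\<forall>z\<in>orth_hyperplane v. orthogonal (x - y) z)"
proof -
  let ?p = "orth_proj v x"
  have p: "?p \<in> orth_hyperplane v"
    using assms by (simp add: orth_hyperplane_def orth_proj_def inner_diff_right)
  have o: "orthogonal (x - ?p) z" if "z \<in> orth_hyperplane v" for z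
    using that by (simp add: orth_hyperplane_def orth_proj_def orthogonal_def)
  have "?p = y"
    if y: "y \<in> orth_hyperplane v" and oy: "\<forall>z\<in>orth_hyperplane v. orthogonal (x - y) z"
  proof -
    have "?p - y \<in> orth_hyperplane v"
      using p y by (simp add: orth_hyperplane_def inner_diff_right)
    then have "(x - y) \<bullet> (?p - y) = 0" "(x - ?p) \<bullet> (?p - y) = 0"
      using o oy by (auto simp: orthogonal_def)
    then have "(?p - y) \<bullet> (?p - y) = 0"
      by (simp add: inner_diff_left)
    then show ?thesis by simp
  qed
  then show ?thesis using p o by blast
qed

end

theory Submission
  imports Defs
begin

text \<open>
  Compressing \<open>A\<close> and \<open>B\<close> simultaneously along a direction (pushing every fibre down to heights
  \<open>0, 1, 2, \<dots>\<close>) keeps the cardinalities, does not enlarge \<open>A + B\<close>, and does not raise the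
  dimension of \<open>B\<close>. Compressing first along \<open>v\<close> and then only along directions transversal to \<open>v\<close>
  also keeps the numbers of lines parallel to \<open>v\<close>. Since \<open>A + B\<close> is full-dimensional, there is a
  basis consisting of \<open>v\<close> and of differences of points of \<open>A\<close> or of \<open>B\<close>; in these coordinates
  compression leads to down-closed sets of nonnegative integer vectors which together contain all
  unit vectors.

  If some unit vector \<open>unit c\<close> other than \<open>v\<close> lies in both sets, compress further along
  \<open>unit k - m *\<^sub>R unit c\<close>, where \<open>m *\<^sub>R unit c\<close> is the last multiple of \<open>unit c\<close> in \<open>A\<close> (or in
  \<open>B\<close>) and \<open>unit k\<close> lies in the same set. A pair that is stable under all these operations consists
  of combs: the lines of \<open>A\<close> pass through \<open>0, unit c, \<dots>, p *\<^sub>R unit c\<close> and through further unit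
  vectors, the teeth, and similarly for \<open>B\<close>. For the two-dimensional cores, averaging over lattice
  paths bounds the sumset, and every further coordinate contributes another \<open>|A|\<close>, another \<open>|B|\<close>,
  or the mean of both. If no such \<open>unit c\<close> exists, the supports of \<open>A\<close> and \<open>B\<close> are complementary
  and the sums of distinct pairs of lines are distinct lines.
\<close>

section \<open>Sumsets and fibres\<close>

lemma card_plus_ge_linorder:
  fixes P Q :: "'a::linordered_cancel_ab_semigroup_add set"
  assumes "finite P" "P \<noteq> {}" "finite Q" "Q \<noteq> {}"
  shows "card P + card Q \<le> card (P + Q) + 1"
proof -
  let ?P = "(\<lambda>x. x + Min Q) ` P" and ?Q = "(\<lambda>y. Max P + y) ` Q"
  have "?P \<inter> ?Q \<subseteq> {Max P + Min Q}"
  proof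
    fix z assume "z \<in> ?P \<inter> ?Q"
    then obtain x y where z: "x \<in> P" "z = x + Min Q" "y \<in> Q" "z = Max P + y" by blast
    have "z \<le> Max P + Min Q" using z(1,2) assms by (simp add: add_right_mono)
    moreover have "Max P + Min Q \<le> z" using z(3,4) assms by (simp add: add_left_mono)
    ultimately show "z \<in> {Max P + Min Q}" by simp
  qed
  then have "card (?P \<inter> ?Q) \<le> 1" using card_mono[of "{Max P + Min Q}"] by simp
  moreover have "?P \<union> ?Q \<subseteq> P + Q"
    using Min_in[OF assms(3,4)] Max_in[OF assms(1,2)] by (auto simp: set_plus_def)
  then have "card (?P \<union> ?Q) \<le> card (P + Q)"
    using assms by (intro card_mono finite_set_plus) auto
  moreover have "card ?P = card P" "card ?Q = card Q"
    by (auto intro!: card_image inj_onI)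
  ultimately show ?thesis using card_Un_Int[of ?P ?Q] assms by simp
qed

lemma linear_image_set_plus:
  assumes "linear f" shows "f ` (A + B) = f ` A + f ` B"
proof (intro equalityI subsetI)
  fix z assume "z \<in> f ` A + f ` B"
  then obtain a b where "a \<in> A" "b \<in> B" "z = f (a + b)"
    by (auto simp: linear_add[OF assms] elim!: set_plus_elim)
  then show "z \<in> f ` (A + B)" by blast
next
  fix z assume "z \<in> f ` (A + B)"
  then show "z \<in> f ` A + f ` B"
    by (auto simp: linear_add[OF assms] elim!: set_plus_elim intro!: set_plus_intro imageI)
qed

lemma sum_card_fibres:
  assumes "finite A" "finite N" "inj_on g N"
  shows "(\<Sum>n\<in>N. card {x \<in> A. f x = g n}) = card {x \<in> A. f x \<in> g ` N}"
proof -
  have "{x \<in> A. f x \<in> g ` N} = (\<Union>n\<in>N. {x \<in> A. f x = g n})" by auto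
  then show ?thesis
    using assms by (auto simp: inj_on_def intro!: card_UN_disjoint[symmetric])
qed

lemma card_image_eq_if_same_fibres:
  assumes "\<And>x y. x \<in> A \<Longrightarrow> y \<in> A \<Longrightarrow> f x = f y \<longleftrightarrow> g x = g y"
  shows "card (f ` A) = card (g ` A)"
proof (rule bij_betw_same_card)
  let ?h = "\<lambda>u. g (inv_into A f u)"
  have "?h (f x) = g x" if "x \<in> A" for x
    using that assms by (metis f_inv_into_f image_eqI inv_into_into)
  then have "inj_on ?h (f ` A)" "?h ` f ` A = g ` A"
    using assms by (auto simp: inj_on_def image_iff)
  then show "bij_betw ?h (f ` A) (g ` A)" by (simp add: bij_betw_def)
qed

lemma card_plus_ge_three_levels:
  fixes f :: "'a::real_vector \<Rightarrow> real"
  assumes linear: "linear f" and fin: "finite A0" "finite A1" "finite B0" "finite B1"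
    and level0: "\<And>x. x \<in> A0 \<union> B0 \<Longrightarrow> f x = 0" and level1: "\<And>x. x \<in> A1 \<union> B1 \<Longrightarrow> f x = 1"
  shows "card (A0 + B0) + card ((A0 + B1) \<union> (A1 + B0)) + card (A1 + B1)
    \<le> card ((A0 \<union> A1) + (B0 \<union> B1))"
proof -
  let ?U = "A0 + B0" and ?V = "(A0 + B1) \<union> (A1 + B0)" and ?W = "A1 + B1"
  have "f x = 0" if "x \<in> ?U" for x
    using that level0 by (auto elim!: set_plus_elim simp: linear_add[OF linear])
  moreover have "f x = 1" if "x \<in> ?V" for x
    using that level0 level1 by (auto elim!: set_plus_elim simp: linear_add[OF linear])
  moreover have "f x = 2" if "x \<in> ?W" for x
    using that level1 by (auto elim!: set_plus_elim simp: linear_add[OF linear])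
  ultimately have "?U \<inter> ?V = {}" "(?U \<union> ?V) \<inter> ?W = {}" by fastforce+
  then have "card ?U + card ?V + card ?W = card (?U \<union> ?V \<union> ?W)"
    using fin by (simp only: card_Un_disjoint finite_UnI finite_set_plus)
  also have "\<dots> \<le> card ((A0 \<union> A1) + (B0 \<union> B1))"
    using fin by (intro card_mono) (auto simp: finite_set_plus Un_set_plus set_plus_Un)
  finally show ?thesis .
qed

lemma card_le_card_plus:
  fixes A B :: "'a::cancel_semigroup_add set"
  assumes "finite A" "finite B" "B \<noteq> {}"
  shows "card A \<le> card (A + B)"
proof -
  obtain b where "b \<in> B" using assms by blast
  then have "(\<lambda>x. x + b) ` A \<subseteq> A + B" by auto
  moreover have "card ((\<lambda>x. x + b) ` A) = card A" by (intro card_image) (simp add: inj_on_def)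
  ultimately show ?thesis using assms card_mono finite_set_plus by metis
qed

section \<open>Arithmetic of the bound\<close>

definition sumset_bound :: "real \<Rightarrow> real \<Rightarrow> real \<Rightarrow> real \<Rightarrow> real \<Rightarrow> real \<Rightarrow> real" where
  "sumset_bound d c r s a b =
    a + (d + 1 - 1 / (r - d + 2) - 1 / (s - c + 2)) * b - (d - 1) * (r + s)"

lemma sumset_bound_le_left:
  fixes r s d c a :: real
  assumes "1 \<le> s" "s + 1 \<le> d" "d \<le> r" "c \<le> s"
  shows "sumset_bound d c r s a s \<le> a"
proof -
  have "0 \<le> 1 / (r - d + 2)" "0 \<le> 1 / (s - c + 2)" using assms by simp_all
  then have "(d + 1 - 1 / (r - d + 2) - 1 / (s - c + 2)) * s \<le> (d + 1) * s"
    using assms by (intro mult_right_mono) linarith+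
  also have "\<dots> \<le> (d - 1) * (r + s)"
  proof -
    have "(d - 2) * (s - 1) \<ge> 0" using assms by simp
    moreover have "(d - 1) * (s + 1) \<le> (d - 1) * r" using assms by (intro mult_left_mono) auto
    ultimately show ?thesis using assms by (simp add: algebra_simps)
  qed
  finally show ?thesis by (simp add: sumset_bound_def)
qed

lemma sumset_bound_le_if_unique_lines:
  fixes a b r s d :: nat and c \<sigma> :: real
  assumes unique: "real r * b + real s * a \<le> \<sigma> + real r * s"
    and "b \<le> a" "r \<le> a" "d \<le> r" "2 \<le> d" "1 \<le> s"
    and c_bounds: "c \<le> s" "s = 1 \<Longrightarrow> r = d \<Longrightarrow> c = 1"
  shows "sumset_bound d c r s a b \<le> \<sigma>"
proof -
  define \<delta> where "\<delta> = 1 / (real r - d + 2) + 1 / (real s - c + 2)"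
  have bound: "sumset_bound d c r s a b = a + (real d + 1 - \<delta>) * b - (real d - 1) * (real r + s)"
    by (simp add: sumset_bound_def \<delta>_def diff_diff_eq)
  have "0 \<le> \<delta>" using assms by (simp add: \<delta>_def)
  then have coefficient_le: "(real d + 1 - \<delta>) * b \<le> (real d + 1) * b"
    by (intro mult_right_mono) auto
  have lines_le: "1 * (real r + s) \<le> (real d - 1) * (real r + s)"
    using assms by (intro mult_right_mono) auto
  consider (more_lines) "d + 1 \<le> r" | (several_lines) "r = d" "2 \<le> s"
    | (single_line) "r = d" "s = 1" using assms by linarith
  then show ?thesis
  proof cases
    case more_lines
    have "(real r - (real d + 1)) * b \<ge> 0" using more_lines by simp
    moreover have "(real s - 1) * (real a - real r) \<ge> 0" using assms by simp
    ultimately show ?thesis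
      using unique coefficient_le lines_le unfolding bound by (simp add: algebra_simps)
  next
    case several_lines
    have "(real s - 2) * (real a - real r) \<ge> 0" using assms several_lines by simp
    moreover have "(real d - 1) * (real d + 2) \<le> (real d - 1) * (real r + real s)"
      using assms several_lines by (intro mult_left_mono) auto
    moreover have "(real d - 2) * (real d + 1) \<ge> 0" using assms by simp
    ultimately show ?thesis
      using unique coefficient_le assms(2) several_lines unfolding bound
      by (simp add: algebra_simps)
  next
    case single_line
    then have "\<delta> = 1" using c_bounds by (simp add: \<delta>_def)
    then show ?thesis using unique lines_le single_line unfolding bound by (simp add: algebra_simps)
  qed
qed

lemma sumset_bound_le_if_weighted_bound:
  fixes a b \<mu> \<nu> L M r s c d \<sigma> :: real
  assumes weighted: "\<mu> * a + \<nu> * b - (d - 1) * (r + s) \<le> \<sigma>"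
    and b_le_a: "b \<le> a" "0 \<le> b" and \<mu>_ge: "1 \<le> \<mu>"
    and weights: "\<mu> + \<nu> = (L + M - 1) / L + (L + M - 1) / M + (d - 2)"
    and L_ge: "0 < r - d + 2" "r - d + 2 \<le> L" and M_ge: "0 < s - c + 2" "s - c + 2 \<le> M"
  shows "sumset_bound d c r s a b \<le> \<sigma>"
proof -
  let ?\<kappa> = "d + 1 - 1 / (r - d + 2) - 1 / (s - c + 2)"
  have L_pos: "L > 0" and M_pos: "M > 0" using L_ge M_ge by auto
  have "2 \<le> M / L + L / M" using L_pos M_pos sum_squares_ge_zero[of "L - M" 0]
    by (simp add: field_simps power2_eq_square)
  moreover have "(L + M - 1) / L + (L + M - 1) / M = 2 + (M / L + L / M) - 1 / L - 1 / M"
    using L_pos M_pos by (simp add: add_divide_distrib diff_divide_distrib)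
  moreover have "1 / L \<le> 1 / (r - d + 2)" "1 / M \<le> 1 / (s - c + 2)"
    using L_ge M_ge by (auto intro: divide_left_mono)
  ultimately have "?\<kappa> \<le> \<mu> + \<nu> - 1" using weights by linarith
  then have "?\<kappa> * b \<le> (\<mu> + \<nu> - 1) * b" using b_le_a(2) by (rule mult_right_mono)
  also have "\<dots> = (\<mu> - 1) * b + \<nu> * b" by (simp add: algebra_simps)
  also have "\<dots> \<le> (\<mu> - 1) * a + \<nu> * b"
    using b_le_a \<mu>_ge by (intro add_right_mono mult_left_mono) auto
  finally show ?thesis using weighted unfolding sumset_bound_def by (simp add: algebra_simps)
qed

section \<open>Compression along a direction\<close>

locale compression =
  fixes w :: "'a::real_vector" and \<tau> :: "'a \<Rightarrow> real"
  assumes linear_height: "linear \<tau>" and height_w [simp]: "\<tau> w = 1"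
begin

definition base :: "'a \<Rightarrow> 'a" where "base x = x - \<tau> x *\<^sub>R w"

definition fibre :: "'a set \<Rightarrow> 'a \<Rightarrow> 'a set" where "fibre A u = {x \<in> A. base x = u}"

definition rank :: "'a set \<Rightarrow> 'a \<Rightarrow> nat" where
  "rank A x = card {y \<in> A. base y = base x \<and> \<tau> y < \<tau> x}"

definition push :: "'a set \<Rightarrow> 'a \<Rightarrow> 'a" where
  "push A x = base x + real (rank A x) *\<^sub>R w"

definition compress :: "'a set \<Rightarrow> 'a set" where "compress A = push A ` A"

lemma height_simps [simp]: "\<tau> (x + y) = \<tau> x + \<tau> y" "\<tau> (x - y) = \<tau> x - \<tau> y"
  "\<tau> (r *\<^sub>R x) = r * \<tau> x" "\<tau> 0 = 0"
  using linear_height by (simp_all add: linear_add linear_diff linear_scale linear_0)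

lemma linear_base: "linear base"
  unfolding base_def by (rule linearI) (simp_all add: algebra_simps)

lemma base_simps [simp]: "base (x + y) = base x + base y" "base (x - y) = base x - base y"
  "base (r *\<^sub>R x) = r *\<^sub>R base x" "base w = 0" "base 0 = 0" "\<tau> (base x) = 0"
  "base (base x) = base x"
  by (simp_all add: base_def scaleR_diff_right scaleR_add_left scaleR_diff_left)

lemma base_eq_self: "\<tau> x = 0 \<Longrightarrow> base x = x"
  by (simp add: base_def)

lemma base_height: "base x + \<tau> x *\<^sub>R w = x"
  by (simp add: base_def)

lemma base_height_eqI: "base x = base y \<Longrightarrow> \<tau> x = \<tau> y \<Longrightarrow> x = y"
  by (metis base_height)

lemma diff_eq_if_base_eq: "base x = base y \<Longrightarrow> x - y = (\<tau> x - \<tau> y) *\<^sub>R w"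
  by (rule base_height_eqI) simp_all

lemma base_eq_iff: "base x = base y \<longleftrightarrow> (\<exists>t. x - y = t *\<^sub>R w)"
proof
  assume "\<exists>t. x - y = t *\<^sub>R w"
  then have "base (x - y) = 0" by fastforce
  then show "base x = base y" by simp
qed (blast dest: diff_eq_if_base_eq)

lemma push_simps [simp]: "base (push A x) = base x" "\<tau> (push A x) = real (rank A x)"
  by (simp_all add: push_def)

lemma push_eq: "push A x = x - (\<tau> x - real (rank A x)) *\<^sub>R w"
  unfolding push_def base_def by (simp add: scaleR_left_diff_distrib)

lemma base_image_compress [simp]: "base ` compress A = base ` A"
  by (simp add: compress_def image_image)

lemma finite_fibre [simp]: "finite A \<Longrightarrow> finite (fibre A u)"
  by (simp add: fibre_def)

lemma fibre_eq_empty_iff: "fibre A u = {} \<longleftrightarrow> u \<notin> base ` A"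
  by (auto simp: fibre_def)

lemma inj_on_height_fibre: "inj_on \<tau> (fibre A u)"
  by (auto simp: inj_on_def fibre_def dest: base_height_eqI)

lemma sum_card_fibre: "finite A \<Longrightarrow> (\<Sum>u\<in>base ` A. card (fibre A u)) = card A"
  unfolding fibre_def using sum_card_fibres[of A "base ` A" "\<lambda>u. u" base] by (simp cong: conj_cong)

lemma rank_less:
  assumes "finite A" "x \<in> A" "y \<in> A" "base x = base y" "\<tau> x < \<tau> y"
  shows "rank A x < rank A y"
  unfolding rank_def using assms by (intro psubset_card_mono) auto

lemma eq_if_rank_eq:
  assumes "finite A" "x \<in> A" "y \<in> A" "base x = base y" "rank A x = rank A y"
  shows "x = y"
  using assms rank_less[of A x y] rank_less[of A y x] base_height_eqI
  by (metis less_irrefl linorder_neqE)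

lemma rank_image_fibre:
  assumes "finite A" shows "rank A ` fibre A u = {..<card (fibre A u)}"
proof (rule card_subset_eq)
  show "rank A ` fibre A u \<subseteq> {..<card (fibre A u)}"
    unfolding rank_def using assms by (auto simp: fibre_def intro!: psubset_card_mono)
  have "inj_on (rank A) (fibre A u)"
    using eq_if_rank_eq[OF assms] by (auto simp: inj_on_def fibre_def)
  then show "card (rank A ` fibre A u) = card {..<card (fibre A u)}"
    by (simp add: card_image)
qed simp

lemma mem_compress:
  assumes "finite A"
  shows "x \<in> compress A \<longleftrightarrow> (\<exists>n<card (fibre A (base x)). \<tau> x = real n)"
proof -
  have "x \<in> compress A \<longleftrightarrow> (\<exists>y\<in>fibre A (base x). \<tau> x = real (rank A y))"
  proof
    assume "\<exists>y\<in>fibre A (base x). \<tau> x = real (rank A y)"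
    then obtain y where "y \<in> A" "base (push A y) = base x" "\<tau> (push A y) = \<tau> x"
      by (auto simp: fibre_def)
    then show "x \<in> compress A" unfolding compress_def using base_height_eqI by blast
  qed (auto simp: compress_def fibre_def)
  also have "\<dots> \<longleftrightarrow> (\<exists>n\<in>rank A ` fibre A (base x). \<tau> x = real n)" by blast
  finally show ?thesis by (simp add: rank_image_fibre[OF assms] Bex_def)
qed

lemma inj_on_push: "finite A \<Longrightarrow> inj_on (push A) A"
  by (rule inj_onI) (metis eq_if_rank_eq push_simps of_nat_eq_iff)

lemma card_compress: "finite A \<Longrightarrow> card (compress A) = card A"
  unfolding compress_def by (intro card_image inj_on_push)

lemma finite_compress: "finite A \<Longrightarrow> finite (compress A)"
  unfolding compress_def by simp

lemma base_mem_compress: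
  assumes "finite A" "x \<in> A" shows "base x \<in> compress A"
proof -
  have "fibre A (base x) \<noteq> {}" using assms by (auto simp: fibre_def)
  then show ?thesis using assms by (simp add: mem_compress card_gt_0_iff)
qed

lemma base_plus_mem_compress:
  assumes "finite A" "x \<in> A" "x + w \<in> A" shows "base x + w \<in> compress A"
proof -
  have "w \<noteq> 0" using height_w by force
  then have "card {x, x + w} = 2" by simp
  moreover have "card {x, x + w} \<le> card (fibre A (base x))"
    using assms by (intro card_mono) (auto simp: fibre_def)
  ultimately show ?thesis
    using assms by (auto simp: mem_compress intro!: exI[of _ 1])
qed

lemma height_compress_Nats: "finite A \<Longrightarrow> x \<in> compress A \<Longrightarrow> \<tau> x \<in> \<nat>"
  by (auto simp: mem_compress)

lemma compress_diff_mem: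
  assumes "finite A" "x \<in> compress A" "\<tau> x \<ge> 1"
  shows "x - w \<in> compress A"
proof -
  obtain n where "n < card (fibre A (base x))" "\<tau> x = real n"
    using assms mem_compress by blast
  then have "n - 1 < card (fibre A (base (x - w)))" "\<tau> (x - w) = real (n - 1)"
    using assms(3) by (auto simp: of_nat_diff)
  then show ?thesis unfolding mem_compress[OF assms(1)] by blast
qed

lemma compress_transversal_diff_mem:
  assumes "finite A" "\<tau> s = 0" and "\<And>y. y \<in> A \<Longrightarrow> base y = base x \<Longrightarrow> y - s \<in> A"
    and "x \<in> compress A"
  shows "x - s \<in> compress A"
proof -
  have "(\<lambda>y. y - s) ` fibre A (base x) \<subseteq> fibre A (base (x - s))"
    using assms(3) by (auto simp: fibre_def)
  moreover have "card ((\<lambda>y. y - s) ` fibre A (base x)) = card (fibre A (base x))"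
    by (intro card_image) (auto simp: inj_on_def)
  ultimately have "card (fibre A (base x)) \<le> card (fibre A (base (x - s)))"
    using assms(1) card_mono finite_fibre by metis
  then show ?thesis
    using assms by (auto simp: mem_compress simp del: base_simps intro: less_le_trans)
qed

lemma compress_filter:
  assumes "\<And>x y. base x = base y \<Longrightarrow> P x = P y"
  shows "compress {x \<in> A. P x} = {x \<in> compress A. P x}"
proof -
  have "rank {x \<in> A. P x} x = rank A x" if "P x" for x
    unfolding rank_def using assms that by (intro arg_cong[where f = card]) blast
  then have "push {x \<in> A. P x} x = push A x" if "P x" for x
    using that by (simp add: push_def)
  moreover have "P (push A x) = P x" for x by (rule assms) simp
  ultimately show ?thesis unfolding compress_def by auto
qed

lemma rank_le_height:
  assumes "finite A" "\<And>x. x \<in> A \<Longrightarrow> \<tau> x \<in> \<nat>" "x \<in> A"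
  shows "real (rank A x) \<le> \<tau> x"
proof -
  obtain n where n: "\<tau> x = real n" using assms(2)[OF assms(3)] by (rule Nats_cases)
  let ?Y = "{y \<in> A. base y = base x \<and> \<tau> y < \<tau> x}"
  have "\<tau> ` ?Y \<subseteq> real ` {..<n}"
  proof
    fix t assume "t \<in> \<tau> ` ?Y"
    then obtain y where "y \<in> A" "t = \<tau> y" "\<tau> y < real n" using n by auto
    moreover from this obtain m where "\<tau> y = real m" using assms(2) Nats_cases by blast
    ultimately show "t \<in> real ` {..<n}" by simp
  qed
  then have "card (\<tau> ` ?Y) \<le> card (real ` {..<n})" by (intro card_mono) auto
  moreover have "card (\<tau> ` ?Y) = card ?Y"
    by (intro card_image inj_on_subset[OF inj_on_height_fibre[of A "base x"]])
      (auto simp: fibre_def)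
  moreover have "card (real ` {..<n}) = n" by (simp add: card_image)
  ultimately show ?thesis by (simp add: rank_def n)
qed

context
  fixes A :: "'a set" and \<phi> :: "'a \<Rightarrow> real"
  assumes finite_A: "finite A" and height_Nats: "\<And>x. x \<in> A \<Longrightarrow> \<tau> x \<in> \<nat>"
    and linear_\<phi>: "linear \<phi>" and \<phi>_w_pos: "\<phi> w > 0"
begin

lemma functional_push: "\<phi> (push A x) = \<phi> x - (\<tau> x - real (rank A x)) * \<phi> w"
  using linear_\<phi> by (simp add: push_eq linear_diff linear_scale)

lemma functional_push_le: "x \<in> A \<Longrightarrow> \<phi> (push A x) \<le> \<phi> x"
  using rank_le_height[OF finite_A height_Nats] \<phi>_w_pos by (simp add: functional_push)

lemma sum_compress: "sum \<phi> (compress A) = (\<Sum>x\<in>A. \<phi> (push A x))"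
  unfolding compress_def using inj_on_push[OF finite_A] by (simp add: sum.reindex)

lemma sum_compress_le: "sum \<phi> (compress A) \<le> sum \<phi> A"
  unfolding sum_compress by (intro sum_mono functional_push_le)

lemma compress_eq_self_if_sum_eq:
  assumes "sum \<phi> (compress A) = sum \<phi> A"
  shows "compress A = A"
proof -
  have "\<phi> (push A x) = \<phi> x" if "x \<in> A" for x
    using sum_mono_inv[OF assms[unfolded sum_compress] functional_push_le that finite_A] .
  then have "\<tau> x = real (rank A x)" if "x \<in> A" for x
    using that \<phi>_w_pos by (simp add: functional_push)
  then have "push A x = x" if "x \<in> A" for x
    using that by (simp add: push_eq)
  then show ?thesis by (simp add: compress_def)
qed

end

lemma card_plus_ge_in_lines:
  assumes "finite P" "P \<noteq> {}" "finite Q" "Q \<noteq> {}"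
    and "\<And>x. x \<in> P \<Longrightarrow> base x = u" "\<And>y. y \<in> Q \<Longrightarrow> base y = u'"
  shows "card P + card Q \<le> card (P + Q) + 1"
proof -
  have card_height_image: "card (\<tau> ` S) = card S" if "\<And>x. x \<in> S \<Longrightarrow> base x = t" for S t
    using that by (intro card_image) (auto simp: inj_on_def dest: base_height_eqI)
  have "card (\<tau> ` (P + Q)) = card (P + Q)"
    by (rule card_height_image[of _ "u + u'"]) (use assms in \<open>auto simp: set_plus_def\<close>)
  moreover have "card (\<tau> ` P) = card P" "card (\<tau> ` Q) = card Q"
    using card_height_image assms by blast+
  moreover have "\<tau> ` (P + Q) = \<tau> ` P + \<tau> ` Q"
    by (rule linear_image_set_plus[OF linear_height])
  ultimately show ?thesis using card_plus_ge_linorder[of "\<tau> ` P" "\<tau> ` Q"] assms by simp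
qed

lemma compress_plus_subset:
  assumes "finite A" "finite B"
  shows "compress A + compress B \<subseteq> compress (A + B)"
proof
  fix z assume "z \<in> compress A + compress B"
  then obtain x y where z: "z = x + y" "x \<in> compress A" "y \<in> compress B"
    by (auto simp: set_plus_def)
  obtain n m where n: "n < card (fibre A (base x))" "\<tau> x = real n"
    and m: "m < card (fibre B (base y))" "\<tau> y = real m"
    using z assms by (auto simp: mem_compress)
  have "fibre A (base x) + fibre B (base y) \<subseteq> fibre (A + B) (base z)"
    by (auto simp: fibre_def set_plus_def z)
  then have "card (fibre A (base x) + fibre B (base y)) \<le> card (fibre (A + B) (base z))"
    using assms by (intro card_mono) (auto simp: finite_set_plus)
  moreover have "card (fibre A (base x)) + card (fibre B (base y))
      \<le> card (fibre A (base x) + fibre B (base y)) + 1"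
  proof (rule card_plus_ge_in_lines)
    show "fibre A (base x) \<noteq> {}" "fibre B (base y) \<noteq> {}" using n m by force+
  qed (use assms in \<open>auto simp: fibre_def\<close>)
  ultimately have "n + m < card (fibre (A + B) (base z))" using n m by linarith
  then show "z \<in> compress (A + B)"
    using n m z assms by (auto simp: mem_compress finite_set_plus intro!: exI[of _ "n + m"])
qed

lemma card_compress_plus_le:
  assumes "finite A" "finite B"
  shows "card (compress A + compress B) \<le> card (A + B)"
  using card_mono[OF _ compress_plus_subset[OF assms]] assms
  by (simp add: finite_compress finite_set_plus card_compress)

lemma card_plus_eq_sum_fibres:
  assumes fin: "finite P" "finite Q"
    and base_unique: "\<And>x x' y y'. x \<in> P \<Longrightarrow> x' \<in> P \<Longrightarrow> y \<in> Q \<Longrightarrow> y' \<in> Q \<Longrightarrow> x + y = x' + y' \<Longrightarrow>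
      base x = base x'"
  shows "card (P + Q) = (\<Sum>u\<in>base ` P. card (fibre P u + Q))"
proof -
  have disjoint: "(fibre P u + Q) \<inter> (fibre P u' + Q) = {}" if "u \<noteq> u'" for u u'
  proof (rule equals0I)
    fix z assume "z \<in> (fibre P u + Q) \<inter> (fibre P u' + Q)"
    then obtain x y x' y' where "x \<in> P" "base x = u" "y \<in> Q" "x' \<in> P" "base x' = u'" "y' \<in> Q"
      and "x + y = x' + y'"
      by (auto simp: fibre_def elim!: set_plus_elim)
    then show False using that base_unique by blast
  qed
  have "P + Q = (\<Union>u\<in>base ` P. fibre P u + Q)"
    by (auto simp: set_plus_def fibre_def)
  also have "card \<dots> = (\<Sum>u\<in>base ` P. card (fibre P u + Q))"
    using fin disjoint by (intro card_UN_disjoint) (auto simp: finite_set_plus)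
  finally show ?thesis .
qed

lemma card_plus_line_ge:
  assumes finite_P: "finite P" and Q_line: "finite Q" "Q \<noteq> {}" "\<And>y. y \<in> Q \<Longrightarrow> base y = u"
  shows "card P + card (base ` P) * card Q \<le> card (P + Q) + card (base ` P)"
proof -
  have "(\<Sum>t\<in>base ` P. card (fibre P t) + card Q) \<le> (\<Sum>t\<in>base ` P. card (fibre P t + Q) + 1)"
  proof (rule sum_mono)
    fix t assume "t \<in> base ` P"
    then show "card (fibre P t) + card Q \<le> card (fibre P t + Q) + 1"
      using finite_P Q_line by (intro card_plus_ge_in_lines[of _ _ t u]) (auto simp: fibre_def)
  qed
  moreover have "card (P + Q) = (\<Sum>t\<in>base ` P. card (fibre P t + Q))"
  proof (rule card_plus_eq_sum_fibres[OF finite_P Q_line(1)])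
    fix x x' y y' assume "y \<in> Q" "y' \<in> Q" "x + y = x' + y'"
    then have "base x + u = base x' + u" using Q_line(3) base_simps(1) by metis
    then show "base x = base x'" by simp
  qed
  ultimately show ?thesis using finite_P by (simp add: sum.distrib sum_Suc sum_card_fibre)
qed

lemma card_plus_ge_if_lines_unique:
  assumes fin: "finite P" "finite Q"
    and base_unique: "\<And>x x' y y'. x \<in> P \<Longrightarrow> x' \<in> P \<Longrightarrow> y \<in> Q \<Longrightarrow> y' \<in> Q \<Longrightarrow> x + y = x' + y' \<Longrightarrow>
      base x = base x'"
  shows "card (base ` P) * card Q + card (base ` Q) * card P
    \<le> card (P + Q) + card (base ` P) * card (base ` Q)"
proof -
  have "(\<Sum>u\<in>base ` P. card Q + card (base ` Q) * card (fibre P u))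
      \<le> (\<Sum>u\<in>base ` P. card (fibre P u + Q) + card (base ` Q))"
  proof (rule sum_mono)
    fix u assume "u \<in> base ` P"
    then have "card Q + card (base ` Q) * card (fibre P u)
        \<le> card (Q + fibre P u) + card (base ` Q)"
      using fin by (intro card_plus_line_ge[of _ _ u]) (auto simp: fibre_def)
    then show "card Q + card (base ` Q) * card (fibre P u)
        \<le> card (fibre P u + Q) + card (base ` Q)"
      by (simp add: add.commute)
  qed
  then show ?thesis
    using fin by (simp add: card_plus_eq_sum_fibres[OF fin base_unique] sum.distrib sum_card_fibre
        flip: sum_distrib_left)
qed

end

lemma aff_dim_le_dim_if_subset_translation:
  fixes V :: "'a::euclidean_space set"
  assumes "B \<subseteq> (\<lambda>x. b + x) ` V" "subspace V"
  shows "aff_dim B \<le> int (dim V)"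
  using aff_dim_subset[OF assms(1)] assms(2) by (simp add: aff_dim_translation_eq aff_dim_subspace)

locale euclidean_compression = compression w \<tau> for w :: "'a::euclidean_space" and \<tau>
begin

lemma aff_dim_compress_le:
  assumes "finite B" shows "aff_dim (compress B) \<le> aff_dim B"
proof (cases "inj_on base B")
  case True
  then have "rank B x = 0" if "x \<in> B" for x
    using that assms by (auto simp: rank_def inj_on_def)
  then have "compress B = base ` B" by (simp add: compress_def push_def)
  then show ?thesis by (simp add: aff_dim_linear_image_le linear_base)
next
  case False
  then obtain b b' where b: "b \<in> B" "b' \<in> B" "base b' = base b" "b' \<noteq> b"
    by (auto simp: inj_on_def)
  let ?V = "span ((\<lambda>x. x - b) ` B)"
  have diff_in_span: "x - b \<in> ?V" if "x \<in> B" for x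
    using that by (intro span_base) blast
  have "\<tau> b' - \<tau> b \<noteq> 0" using b base_height_eqI by auto
  then have "w = inverse (\<tau> b' - \<tau> b) *\<^sub>R (b' - b)" using diff_eq_if_base_eq[OF b(3)] by simp
  then have w_in_span: "w \<in> ?V" using span_scale[OF diff_in_span[OF b(2)]] by metis
  have "compress B \<subseteq> (\<lambda>x. b + x) ` ?V"
  proof
    fix x assume "x \<in> compress B"
    then obtain y where y: "y \<in> B" "x = push B y" by (auto simp: compress_def)
    then have "x - b = (y - b) - (\<tau> y - real (rank B y)) *\<^sub>R w" by (simp add: push_eq)
    also have "\<dots> \<in> ?V" by (intro span_diff span_scale w_in_span diff_in_span y)
    finally show "x \<in> (\<lambda>x. b + x) ` ?V" by (rule rev_image_eqI) simp
  qed
  then have "aff_dim (compress B) \<le> int (dim ?V)"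
    by (rule aff_dim_le_dim_if_subset_translation) simp
  then show ?thesis
    using aff_dim_eq_dim_subtract[of b B] b(1) by (simp add: hull_inc)
qed

end

section \<open>Reductions that keep the line counts\<close>

definition line_count :: "'a::real_inner \<Rightarrow> 'a set \<Rightarrow> nat" where
  "line_count v A = card (orth_proj v ` A)"

lemma orth_proj_eq_iff:
  assumes "v \<noteq> 0" shows "orth_proj v x = orth_proj v y \<longleftrightarrow> (\<exists>t. x - y = t *\<^sub>R v)"
proof
  assume "orth_proj v x = orth_proj v y"
  then have "x - y = ((v \<bullet> x) / (v \<bullet> v) - (v \<bullet> y) / (v \<bullet> v)) *\<^sub>R v"
    by (simp add: orth_proj_def algebra_simps)
  then show "\<exists>t. x - y = t *\<^sub>R v" by blast
next
  assume "\<exists>t. x - y = t *\<^sub>R v"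
  then obtain t where "x = y + t *\<^sub>R v" by (metis add.commute diff_add_cancel)
  then show "orth_proj v x = orth_proj v y"
    using assms by (simp add: orth_proj_def inner_add_right add_divide_distrib algebra_simps)
qed

lemma line_count_le_card: "finite A \<Longrightarrow> line_count v A \<le> card A"
  unfolding line_count_def by (rule card_image_le)

lemma aff_dim_le_line_count:
  fixes B :: "'a::euclidean_space set"
  assumes "finite B" "B \<noteq> {}"
  shows "aff_dim B \<le> int (line_count v B)"
proof -
  obtain b where b: "b \<in> B" using assms by blast
  let ?E = "insert v ((\<lambda>u. u - orth_proj v b) ` (orth_proj v ` B - {orth_proj v b}))"
  have "(\<lambda>x. x - b) ` B \<subseteq> span ?E"
  proof
    fix u assume "u \<in> (\<lambda>x. x - b) ` B"
    then obtain x where x: "x \<in> B" "u = x - b" by blast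
    have u_eq: "u = (orth_proj v x - orth_proj v b) + ((v \<bullet> x) / (v \<bullet> v) - (v \<bullet> b) / (v \<bullet> v)) *\<^sub>R v"
      by (simp add: x orth_proj_def algebra_simps)
    have "orth_proj v x - orth_proj v b \<in> span ?E"
      by (cases "orth_proj v x = orth_proj v b") (auto intro!: span_base simp: span_zero x)
    then show "u \<in> span ?E" unfolding u_eq by (intro span_add span_scale) (auto intro: span_base)
  qed
  then have "dim ((\<lambda>x. x - b) ` B) \<le> card ?E" using assms by (intro dim_le_card) auto
  also have "card ?E \<le> Suc (card ((\<lambda>u. u - orth_proj v b) ` (orth_proj v ` B - {orth_proj v b})))"
    using assms by (intro card_insert_le_m1) auto
  also have "\<dots> \<le> Suc (card (orth_proj v ` B - {orth_proj v b}))"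
    using assms by (simp add: card_image_le)
  also have "\<dots> = line_count v B"
    unfolding line_count_def using assms b by (intro card_Suc_Diff1) auto
  finally show ?thesis using aff_dim_eq_dim_subtract[of b B] b by (simp add: hull_inc)
qed

definition reduces_to :: "'a::euclidean_space \<Rightarrow> 'a set \<Rightarrow> 'a set \<Rightarrow>
    'b::euclidean_space \<Rightarrow> 'b set \<Rightarrow> 'b set \<Rightarrow> bool" where
  "reduces_to v A B v' A' B' \<longleftrightarrow> card A' = card A \<and> card B' = card B \<and>
    line_count v' A' = line_count v A \<and> line_count v' B' = line_count v B \<and>
    card (A' + B') \<le> card (A + B) \<and> aff_dim B' \<le> aff_dim B"

lemma reduces_to_refl: "reduces_to v A B v A B"
  by (simp add: reduces_to_def)

lemma reduces_to_trans:
  "reduces_to v A B v' A' B' \<Longrightarrow> reduces_to v' A' B' v'' A'' B'' \<Longrightarrow> reduces_to v A B v'' A'' B''"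
  by (auto simp: reduces_to_def)

lemma line_count_linear_image:
  assumes "linear f" "inj f" "v \<noteq> 0"
  shows "line_count (f v) (f ` A) = line_count v A"
  unfolding line_count_def image_image
proof (rule card_image_eq_if_same_fibres)
  fix x y
  have "f v \<noteq> 0" using assms by (metis injD linear_0)
  moreover have "f x - f y = t *\<^sub>R f v \<longleftrightarrow> x - y = t *\<^sub>R v" for t
    using assms(1,2) by (simp add: inj_eq flip: linear_diff linear_scale)
  ultimately show "orth_proj (f v) (f x) = orth_proj (f v) (f y) \<longleftrightarrow> orth_proj v x = orth_proj v y"
    using assms(3) by (simp add: orth_proj_eq_iff)
qed

lemma reduces_to_linear_image:
  assumes "linear f" "inj f" "v \<noteq> 0"
  shows "reduces_to v A B (f v) (f ` A) (f ` B)"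
proof -
  have "card (f ` X) = card X" for X
    using assms(2) by (intro card_image) (rule inj_on_subset[OF _ subset_UNIV])
  then show ?thesis
    unfolding reduces_to_def using assms
    by (simp add: line_count_linear_image flip: linear_image_set_plus)
qed

text \<open>What the proof uses about the parameter \<open>c\<close> of the theorem; unlike its definition, this
  survives a reduction of the dimension of \<open>B\<close>.\<close>

definition dim_parameter :: "'a::euclidean_space \<Rightarrow> 'a set \<Rightarrow> int \<Rightarrow> bool" where
  "dim_parameter v B c \<longleftrightarrow> c \<le> int (line_count v B) \<and>
    (if line_count v B < DIM('a) then aff_dim B \<le> c \<and> line_count v B < card B else int DIM('a) \<le> c)"

lemma dim_parameter_reduces_to:
  fixes B :: "'a::euclidean_space set" and B' :: "'b::euclidean_space set"
  assumes "reduces_to v A B v' A' B'" "DIM('a) = DIM('b)" "dim_parameter v B c"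
  shows "dim_parameter v' B' c"
  using assms by (auto simp: dim_parameter_def reduces_to_def split: if_splits)

lemma dim_parameter_eq_one:
  fixes B :: "'a::euclidean_space set"
  assumes "dim_parameter v B c" "line_count v B = 1" "2 \<le> DIM('a)"
  shows "c = 1"
proof -
  have B_bounds: "c \<le> 1" "aff_dim B \<le> c" "1 < card B"
    using assms by (simp_all add: dim_parameter_def)
  then have "aff_dim B \<noteq> 0" "aff_dim B \<noteq> -1" by (auto simp: aff_dim_eq_0 simp flip: aff_dim_empty)
  then show ?thesis using B_bounds aff_dim_geq[of B] by linarith
qed

context euclidean_compression
begin

lemma line_count_eq_card_base: "line_count w A = card (base ` A)"
proof -
  have "w \<noteq> 0" using height_w by force
  then show ?thesis
    unfolding line_count_def
    by (intro card_image_eq_if_same_fibres) (simp add: orth_proj_eq_iff base_eq_iff)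
qed

lemma reduces_to_compress:
  assumes "finite A" "finite B"
    and "line_count v (compress A) = line_count v A" "line_count v (compress B) = line_count v B"
  shows "reduces_to v A B v (compress A) (compress B)"
  using assms aff_dim_compress_le
  by (simp add: reduces_to_def card_compress card_compress_plus_le)

end

section \<open>Down-sets and compression in coordinates\<close>

abbreviation unit :: "'n \<Rightarrow> real ^ 'n" where "unit i \<equiv> axis i 1"

lemma unit_nth: "unit k $ i = (if i = k then 1 else 0)"
  by (simp add: axis_def)

lemma unit_nth_other [simp]: "i \<noteq> k \<Longrightarrow> unit k $ i = 0"
  by (simp add: unit_nth)

lemma card_units_le_aff_dim:
  fixes B :: "(real ^ 'n) set"
  assumes "0 \<in> B" "unit ` F \<subseteq> B" shows "int (card F) \<le> aff_dim B"
proof -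
  have "independent ((unit :: 'n \<Rightarrow> real ^ 'n) ` F)"
    by (rule independent_mono[OF independent_Basis]) (auto simp: axis_in_Basis_iff)
  then have "card ((unit :: 'n \<Rightarrow> real ^ 'n) ` F) \<le> dim B"
    using assms(2) independent_card_le_dim by blast
  moreover have "card ((unit :: 'n \<Rightarrow> real ^ 'n) ` F) = card F"
    by (intro card_image) (auto simp: inj_on_def axis_eq_axis)
  ultimately show ?thesis using assms(1) by (simp add: aff_dim_zero hull_inc)
qed

definition nat_vectors :: "(real ^ 'n) set" where
  "nat_vectors = {x. \<forall>i. x $ i \<in> \<nat>}"

lemma nat_vectors_nth: "x \<in> nat_vectors \<Longrightarrow> x $ i \<in> \<nat>"
  by (simp add: nat_vectors_def)

lemma scaled_unit_nat_vectors [simp]: "real n *\<^sub>R unit k \<in> nat_vectors"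
  by (simp add: nat_vectors_def unit_nth)

lemma unit_nat_vectors [simp]: "unit k \<in> nat_vectors"
  using scaled_unit_nat_vectors[of 1 k] by simp

lemma zero_nat_vectors [simp]: "0 \<in> nat_vectors"
  using scaled_unit_nat_vectors[of 0] by simp

lemma add_nat_vectors [simp]: "x \<in> nat_vectors \<Longrightarrow> y \<in> nat_vectors \<Longrightarrow> x + y \<in> nat_vectors"
  by (simp add: nat_vectors_def)

lemma nat_vectors_nonneg: "x \<in> nat_vectors \<Longrightarrow> 0 \<le> x $ i"
  using nat_vectors_nth[of x i] by (auto elim!: Nats_cases)

lemma nat_vectors_less_iff:
  assumes "x \<in> nat_vectors" "y \<in> nat_vectors"
  shows "y $ i < x $ i \<longleftrightarrow> y $ i + 1 \<le> x $ i"
proof -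
  obtain n m where "x $ i = real n" "y $ i = real m"
    using assms nat_vectors_nth Nats_cases by metis
  then show ?thesis by (simp add: nat_less_real_le)
qed

lemma nat_vectors_ge_one: "x \<in> nat_vectors \<Longrightarrow> x $ i \<noteq> 0 \<Longrightarrow> 1 \<le> x $ i"
  using nat_vectors_less_iff[of x 0 i] nat_vectors_nonneg[of x i] by simp

definition down_set :: "(real ^ 'n) set \<Rightarrow> bool" where
  "down_set A \<longleftrightarrow> A \<subseteq> nat_vectors \<and> (\<forall>x\<in>A. \<forall>y\<in>nat_vectors. y \<le> x \<longrightarrow> y \<in> A)"

lemma down_setD: "down_set A \<Longrightarrow> x \<in> A \<Longrightarrow> y \<in> nat_vectors \<Longrightarrow> (\<And>i. y $ i \<le> x $ i) \<Longrightarrow> y \<in> A"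
  unfolding down_set_def less_eq_vec_def by blast

lemma down_set_nat_vectors: "down_set A \<Longrightarrow> x \<in> A \<Longrightarrow> x \<in> nat_vectors"
  unfolding down_set_def by blast

lemma down_setI:
  assumes nat: "A \<subseteq> nat_vectors" and down: "\<And>x k. x \<in> A \<Longrightarrow> x $ k \<ge> 1 \<Longrightarrow> x - unit k \<in> A"
  shows "down_set A"
proof -
  have "y \<in> A" if "y \<in> nat_vectors" "x \<in> A" "y \<le> x" for x y
    using that(2,3)
  proof (induction "nat \<lfloor>\<Sum>i\<in>UNIV. x $ i - y $ i\<rfloor>" arbitrary: x rule: less_induct)
    case less
    show ?case
    proof (cases "x = y")
      case True
      then show ?thesis using less.prems by simp
    next
      case False
      then obtain k where "y $ k < x $ k"
        using less.prems(2) by (metis vec_eq_iff less_eq_vec_def order_le_less)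
      then have gap: "y $ k + 1 \<le> x $ k"
        using nat less.prems(1) that(1) nat_vectors_less_iff by blast
      let ?x = "x - unit k"
      have x_mem: "?x \<in> A"
        using gap nat_vectors_nonneg[OF that(1), of k] by (intro down less.prems(1)) linarith
      have y_le: "y \<le> ?x"
        using gap less.prems(2) by (auto simp: less_eq_vec_def unit_nth)
      then have "0 \<le> (\<Sum>i\<in>UNIV. ?x $ i - y $ i)"
        by (intro sum_nonneg) (simp add: less_eq_vec_def)
      moreover have "(\<Sum>i\<in>UNIV. ?x $ i - y $ i) = (\<Sum>i\<in>UNIV. x $ i - y $ i) - 1"
        by (simp add: sum_subtractf unit_nth)
      ultimately have "nat \<lfloor>\<Sum>i\<in>UNIV. ?x $ i - y $ i\<rfloor> < nat \<lfloor>\<Sum>i\<in>UNIV. x $ i - y $ i\<rfloor>"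
        by linarith
      then show ?thesis using less.hyps x_mem y_le by blast
    qed
  qed
  then show ?thesis using nat by (auto simp: down_set_def)
qed

lemma unit_mem_down_set:
  assumes "down_set A" "x \<in> A" "x $ i \<noteq> 0" shows "unit i \<in> A"
proof (rule down_setD[OF assms(1,2)])
  have nat: "x \<in> nat_vectors" using assms down_set_nat_vectors by blast
  show "unit i $ j \<le> x $ j" for j
    using nat_vectors_ge_one[OF nat assms(3)] nat_vectors_nonneg[OF nat, of j]
    by (simp add: unit_nth)
qed simp

definition stacked :: "'n \<Rightarrow> (real ^ 'n) set \<Rightarrow> bool" where
  "stacked z A \<longleftrightarrow> finite A \<and> (\<forall>x\<in>A. x $ z \<in> \<nat> \<and> (x $ z \<ge> 1 \<longrightarrow> x - unit z \<in> A))"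

lemma orth_proj_unit: "orth_proj (unit z) x = x - (x $ z) *\<^sub>R unit z"
  by (simp add: orth_proj_def inner_axis')

lemma orth_proj_stacked:
  assumes "stacked z A"
  shows "orth_proj (unit z) ` A = {x \<in> A. x $ z = 0}"
proof (intro equalityI subsetI)
  have "x - real n *\<^sub>R unit z \<in> A" if "x \<in> A" "x $ z = real n" for x n
    using that
  proof (induction n arbitrary: x)
    case (Suc n)
    then have "x - unit z \<in> A" using assms by (simp add: stacked_def)
    then have "x - unit z - real n *\<^sub>R unit z \<in> A" using Suc by simp
    then show ?case by (simp add: algebra_simps)
  qed simp
  moreover fix u assume "u \<in> orth_proj (unit z) ` A"
  then obtain x where "x \<in> A" "u = x - (x $ z) *\<^sub>R unit z" by (auto simp: orth_proj_unit)
  moreover from this obtain n where "x $ z = real n"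
    using assms by (auto simp: stacked_def elim: Nats_cases)
  ultimately show "u \<in> {x \<in> A. x $ z = 0}" by auto
qed (force simp: orth_proj_unit)

abbreviation coord_compress :: "'n \<Rightarrow> real ^ 'n \<Rightarrow> (real ^ 'n) set \<Rightarrow> (real ^ 'n) set" where
  "coord_compress k w \<equiv> compression.compress w (\<lambda>x. x $ k)"

locale coord_compression = euclidean_compression w "\<lambda>x. x $ k"
  for k :: "'n::finite" and w :: "real ^ 'n"
begin

lemma base_unit: "i \<noteq> k \<Longrightarrow> base (unit i) = unit i"
  by (rule base_eq_self) simp

lemma base_nth: "w $ i = 0 \<Longrightarrow> base x $ i = x $ i"
  by (simp add: base_def)

lemma push_nth: "w $ i = 0 \<Longrightarrow> push A x $ i = x $ i"
  by (simp add: push_eq)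

lemma unit_mem_compress: "finite A \<Longrightarrow> unit i \<in> A \<Longrightarrow> i \<noteq> k \<Longrightarrow> unit i \<in> compress A"
  using base_mem_compress[of A "unit i"] base_unit by simp

lemma zero_mem_compress: "finite A \<Longrightarrow> 0 \<in> A \<Longrightarrow> 0 \<in> compress A"
  using base_mem_compress[of A 0] by simp

lemma height_unit_mem_compress:
  assumes "finite A" "unit k \<in> A" "unit k - w \<in> A"
  shows "unit k \<in> compress A"
proof -
  have "base (unit k - w) = unit k - w" using height_w by (intro base_eq_self) simp
  then show ?thesis using base_plus_mem_compress[OF assms(1,3)] assms(2) by simp
qed

lemma compress_subset_nat_vectors:
  assumes w_nonpos: "\<And>i. i \<noteq> k \<Longrightarrow> - w $ i \<in> \<nat>" and A_nat: "finite A" "A \<subseteq> nat_vectors"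
  shows "compress A \<subseteq> nat_vectors"
proof
  fix x assume "x \<in> compress A"
  then obtain y where y: "y \<in> A" "x = push A y" by (auto simp: compress_def)
  have nat: "u $ i \<in> \<nat>" if "u \<in> A" for u i using A_nat that nat_vectors_nth by blast
  obtain n where n: "y $ k = real n" using nat[OF y(1)] Nats_cases by blast
  have "rank A y \<le> n" using rank_le_height[OF A_nat(1) nat y(1)] n by simp
  then have "x $ i = y $ i + real (n - rank A y) * (- w $ i)" for i
    by (simp add: y push_eq n of_nat_diff algebra_simps)
  then have "x $ i \<in> \<nat>" if "i \<noteq> k" for i
    using nat[OF y(1)] w_nonpos[OF that] by (metis Nats_add Nats_mult of_nat_in_Nats)
  moreover have "x $ k \<in> \<nat>" using push_simps(2)[of A y] y by simp
  ultimately have "x $ i \<in> \<nat>" for i by (cases "i = k") auto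
  then show "x \<in> nat_vectors" by (simp add: nat_vectors_def)
qed

context
  fixes z :: 'n and A :: "(real ^ 'n) set"
  assumes w_z: "w $ z = 0" and stacked: "stacked z A"
begin

lemma stacked_compress: "stacked z (compress A)"
  unfolding stacked_def
proof (intro conjI ballI impI)
  have fin: "finite A" using stacked by (simp add: stacked_def)
  then show "finite (compress A)" by (rule finite_compress)
  fix x assume x: "x \<in> compress A"
  then show "x $ z \<in> \<nat>" using stacked w_z by (auto simp: compress_def push_nth stacked_def)
  assume "x $ z \<ge> 1"
  then have "y - unit z \<in> A" if "y \<in> A" "base y = base x" for y
    using that stacked base_nth[OF w_z] by (metis stacked_def)
  moreover have "z \<noteq> k" using height_w w_z by (metis zero_neq_one)
  ultimately show "x - unit z \<in> compress A"
    using fin x by (intro compress_transversal_diff_mem) auto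
qed

lemma line_count_compress: "line_count (unit z) (compress A) = line_count (unit z) A"
proof -
  have "finite A" using stacked by (simp add: stacked_def)
  moreover have "{x \<in> compress A. x $ z = 0} = compress {x \<in> A. x $ z = 0}"
    by (rule compress_filter[symmetric]) (metis base_nth[OF w_z])
  ultimately show ?thesis
    by (simp add: line_count_def orth_proj_stacked stacked stacked_compress card_compress)
qed

end

lemma reduces_to_compress_transversal:
  assumes "w $ z = 0" "stacked z A" "stacked z B"
  shows "reduces_to (unit z) A B (unit z) (compress A) (compress B)"
  using assms line_count_compress
  by (intro reduces_to_compress) (auto simp: stacked_def)

end

lemma coord_compressionI: "w $ k = 1 \<Longrightarrow> coord_compression k w"
  by unfold_locales (auto intro!: linearI)

locale axis_compression = coord_compression z "unit z" for z :: "'n::finite"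
begin

lemma base_eq_orth_proj: "base = orth_proj (unit z)"
  by (auto simp: base_def orth_proj_unit)

lemma base_nth_other: "k \<noteq> z \<Longrightarrow> base x $ k = x $ k"
  by (simp add: base_nth)

lemma fibre_unit_nth: "x \<in> fibre A (unit k) \<Longrightarrow> k \<noteq> z \<Longrightarrow> x $ k = 1"
  by (auto simp: fibre_def simp flip: base_nth_other)

lemma stacked_compress_axis: "finite A \<Longrightarrow> stacked z (compress A)"
  unfolding stacked_def by (blast intro: finite_compress height_compress_Nats compress_diff_mem)

lemma reduces_to_compress_axis:
  assumes "finite A" "finite B"
  shows "reduces_to (unit z) A B (unit z) (compress A) (compress B)"
  using assms by (intro reduces_to_compress) (simp_all add: line_count_eq_card_base)

end

lemma axis_compression: "axis_compression z"
  unfolding axis_compression_def by (rule coord_compressionI) simp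

lemma card_plus_ge_if_disjoint_units:
  fixes A B :: "(real ^ 'n) set"
  assumes fin: "finite A" "finite B" and down: "down_set A" "down_set B"
    and disjoint: "\<And>i. i \<noteq> z \<Longrightarrow> unit i \<notin> A \<inter> B"
  shows "line_count (unit z) A * card B + line_count (unit z) B * card A
    \<le> card (A + B) + line_count (unit z) A * line_count (unit z) B"
proof -
  interpret axis_compression z by (rule axis_compression)
  have "base x = base x'"
    if "x \<in> A" "x' \<in> A" "y \<in> B" "y' \<in> B" "x + y = x' + y'" for x x' y y'
  proof -
    have "x $ i = x' $ i" if "i \<noteq> z" for i
    proof (cases "unit i \<in> A")
      case True
      then have "y $ i = 0" "y' $ i = 0"
        using disjoint[OF that] unit_mem_down_set[OF down(2)] \<open>y \<in> B\<close> \<open>y' \<in> B\<close> by blast+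
      then show ?thesis using \<open>x + y = x' + y'\<close> by (metis vector_add_component add_0_right)
    next
      case False
      then show ?thesis
        using unit_mem_down_set[OF down(1)] \<open>x \<in> A\<close> \<open>x' \<in> A\<close> by metis
    qed
    then show ?thesis by (auto simp: base_def vec_eq_iff unit_nth)
  qed
  then show ?thesis
    unfolding line_count_eq_card_base
    by (rule card_plus_ge_if_lines_unique[OF fin])
qed

section \<open>Reduction to lattice pairs\<close>

definition axis_compressed :: "'n set \<Rightarrow> (real ^ 'n) set \<Rightarrow> bool" where
  "axis_compressed F A \<longleftrightarrow> finite A \<and> (\<forall>x\<in>A. \<forall>i\<in>F. x $ i \<in> \<nat>) \<and> (\<exists>x\<in>A. \<forall>j\<in>F. x $ j = 0)"

definition has_unit_edge :: "'n set \<Rightarrow> 'n \<Rightarrow> (real ^ 'n) set \<Rightarrow> bool" where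
  "has_unit_edge F i A \<longleftrightarrow> (\<exists>x\<in>A. (\<forall>j\<in>F. x $ j = 0) \<and> x + unit i \<in> A)"

context axis_compression
begin

lemma base_vanishes_insert:
  assumes "\<forall>j\<in>F. x $ j = 0" shows "\<forall>j\<in>insert z F. base x $ j = 0"
proof
  show "base x $ j = 0" if "j \<in> insert z F" for j
    using that assms base_nth_other[of j x] by (cases "j = z") auto
qed

lemma axis_compressed_insert:
  assumes "axis_compressed F A" shows "axis_compressed (insert z F) (compress A)"
proof -
  have fin: "finite A" using assms by (simp add: axis_compressed_def)
  have "x $ i \<in> \<nat>" if "x \<in> compress A" "i \<in> insert z F" for x i
  proof (cases "i = z")
    case True
    then show ?thesis using that fin height_compress_Nats by blast
  next
    case False
    then show ?thesis using that assms
      by (auto simp: compress_def push_nth axis_compressed_def)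
  qed
  moreover obtain x where x: "x \<in> A" "\<forall>j\<in>F. x $ j = 0"
    using assms by (auto simp: axis_compressed_def)
  then have "\<exists>x\<in>compress A. \<forall>j\<in>insert z F. x $ j = 0"
    using base_mem_compress[OF fin x(1)] base_vanishes_insert by blast
  ultimately show ?thesis using fin by (simp add: axis_compressed_def finite_compress)
qed

lemma has_unit_edge_insert:
  assumes "finite A" "has_unit_edge F i A" shows "has_unit_edge (insert z F) i (compress A)"
proof -
  obtain x where x: "x \<in> A" "\<forall>j\<in>F. x $ j = 0" "x + unit i \<in> A"
    using assms by (auto simp: has_unit_edge_def)
  have "base x + unit i \<in> compress A"
    using base_plus_mem_compress[OF assms(1) x(1)] base_mem_compress[OF assms(1) x(3)] x(3)
      base_unit by (cases "i = z") auto
  then show ?thesis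
    using base_mem_compress[OF assms(1) x(1)] base_vanishes_insert[OF x(2)]
    unfolding has_unit_edge_def by blast
qed

end

lemma ex_axis_compressed_pair:
  assumes fin: "finite A" "A \<noteq> {}" "finite B" "B \<noteq> {}"
    and edges: "\<And>i. i \<noteq> z \<Longrightarrow> has_unit_edge {} i A \<or> has_unit_edge {} i B"
    and "finite F" "z \<notin> F"
  shows "\<exists>A' B'. reduces_to (unit z) A B (unit z) A' B' \<and> stacked z A' \<and> stacked z B' \<and>
    axis_compressed (insert z F) A' \<and> axis_compressed (insert z F) B' \<and>
    (\<forall>i. i \<noteq> z \<longrightarrow> has_unit_edge (insert z F) i A' \<or> has_unit_edge (insert z F) i B')"
  using \<open>finite F\<close> \<open>z \<notin> F\<close>
proof (induction F rule: finite_induct)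
  case empty
  interpret axis_compression z by (rule axis_compression)
  have "axis_compressed {} A" "axis_compressed {} B"
    using fin by (auto simp: axis_compressed_def)
  then show ?case
    using reduces_to_compress_axis[OF fin(1,3)] stacked_compress_axis fin(1,3)
      axis_compressed_insert has_unit_edge_insert edges
    by meson
next
  case (insert k F)
  then obtain A' B' where red: "reduces_to (unit z) A B (unit z) A' B'"
    and stacked: "stacked z A'" "stacked z B'"
    and compressed: "axis_compressed (insert z F) A'" "axis_compressed (insert z F) B'"
    and unit_edge: "\<And>i. i \<noteq> z \<Longrightarrow> has_unit_edge (insert z F) i A' \<or> has_unit_edge (insert z F) i B'"
    by auto
  interpret axis_compression k by (rule axis_compression)
  have w_z: "unit k $ z = 0" using insert.prems by (simp add: unit_nth)
  have fin': "finite A'" "finite B'" using stacked by (auto simp: stacked_def)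
  have comm: "insert z (insert k F) = insert k (insert z F)" by blast
  have "reduces_to (unit z) A B (unit z) (compress A') (compress B')"
    using red reduces_to_compress_transversal[OF w_z stacked] by (rule reduces_to_trans)
  then show ?case
    unfolding comm
    using stacked_compress[OF w_z] stacked
      axis_compressed_insert[OF compressed(1)] axis_compressed_insert[OF compressed(2)]
      has_unit_edge_insert[OF fin'(1)] has_unit_edge_insert[OF fin'(2)] unit_edge
    by blast
qed

definition lattice_pair :: "'n \<Rightarrow> 'n set \<Rightarrow> (real ^ 'n) set \<Rightarrow> (real ^ 'n) set \<Rightarrow> bool" where
  "lattice_pair z S A B \<longleftrightarrow> stacked z A \<and> stacked z B \<and> A \<union> B \<subseteq> nat_vectors \<and>
    0 \<in> A \<inter> B \<and> (\<forall>i. i \<noteq> z \<longrightarrow> unit i \<in> A \<union> B) \<and> unit ` S \<subseteq> A \<inter> B"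

lemma lattice_pair_finite: "lattice_pair z S A B \<Longrightarrow> finite A \<and> finite B"
  by (simp add: lattice_pair_def stacked_def)

lemma ex_lattice_pair_if_unit_edges:
  assumes "finite A" "A \<noteq> {}" "finite B" "B \<noteq> {}"
    and "\<And>i. i \<noteq> z \<Longrightarrow> has_unit_edge {} i A \<or> has_unit_edge {} i B"
  shows "\<exists>A' B'. reduces_to (unit z) A B (unit z) A' B' \<and> lattice_pair z {} A' B'"
proof -
  obtain A' B' where red: "reduces_to (unit z) A B (unit z) A' B'"
    and stacked: "stacked z A'" "stacked z B'"
    and compressed: "axis_compressed UNIV A'" "axis_compressed UNIV B'"
    and unit_edge: "\<And>i. i \<noteq> z \<Longrightarrow> has_unit_edge UNIV i A' \<or> has_unit_edge UNIV i B'"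
    using ex_axis_compressed_pair[OF assms, where F = "UNIV - {z}"] by (auto simp: insert_UNIV)
  have vanishing_iff: "(\<forall>j. x $ j = 0) \<longleftrightarrow> x = 0" for x :: "real ^ 'n" by (simp add: vec_eq_iff)
  have "A' \<union> B' \<subseteq> nat_vectors" "0 \<in> A' \<inter> B'"
    using compressed by (auto simp: axis_compressed_def vanishing_iff nat_vectors_def)
  moreover have "unit i \<in> A' \<union> B'" if "i \<noteq> z" for i
    using unit_edge[OF that] by (auto simp: has_unit_edge_def vanishing_iff)
  ultimately show ?thesis using red stacked by (auto simp: lattice_pair_def)
qed

definition differences :: "'a::ab_group_add set \<Rightarrow> 'a set" where
  "differences A = {x - y |x y. x \<in> A \<and> y \<in> A}"

lemma span_differences_eq_UNIV:
  fixes A B :: "'a::euclidean_space set"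
  assumes dim: "aff_dim (A + B) = int DIM('a)"
  shows "span (differences A \<union> differences B) = UNIV"
proof -
  let ?D = "differences A \<union> differences B"
  have "A + B \<noteq> {}" using dim by (auto simp: aff_dim_empty[symmetric])
  then obtain a b where ab: "a \<in> A" "b \<in> B" by (auto simp: set_plus_def)
  have "(\<lambda>x. x - (a + b)) ` (A + B) \<subseteq> span ?D"
  proof
    fix u assume "u \<in> (\<lambda>x. x - (a + b)) ` (A + B)"
    then obtain x y where "x \<in> A" "y \<in> B" and u_eq: "u = (x - a) + (y - b)"
      by (auto elim!: set_plus_elim)
    then have "x - a \<in> ?D" "y - b \<in> ?D" using ab by (auto simp: differences_def)
    then show "u \<in> span ?D" unfolding u_eq by (intro span_add span_base)
  qed
  then have "dim ((\<lambda>x. x - (a + b)) ` (A + B)) \<le> dim (span ?D)" by (rule dim_subset)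
  moreover have "int (dim ((\<lambda>x. x - (a + b)) ` (A + B))) = int DIM('a)"
    using aff_dim_eq_dim_subtract[of "a + b" "A + B"] ab dim by (simp add: hull_inc set_plus_intro)
  ultimately have "dim ?D \<ge> DIM('a)" by simp
  then have "dim ?D = DIM('a)" using dim_subset_UNIV[of ?D] by simp
  then show ?thesis by (simp only: dim_eq_full)
qed

lemma ex_basis_in_spanning_set:
  fixes v :: "'a::euclidean_space"
  assumes "span D = UNIV" "v \<noteq> 0"
  obtains E where "v \<in> E" "E \<subseteq> insert v D" "independent E" "card E = DIM('a)"
proof -
  obtain E where E: "{v} \<subseteq> E" "E \<subseteq> insert v D" "independent E" "insert v D \<subseteq> span E"
    using maximal_independent_subset_extend[of "{v}" "insert v D"] assms(2) by auto
  then have "span E = UNIV"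
    using assms(1) by (metis insert_subset span_minimal subspace_span top.extremum_uniqueI)
  then have "card E = DIM('a)" using E(3) dim_span_eq_card_independent[of E] by simp
  then show thesis using E by (intro that[of E]) simp_all
qed

lemma ex_linear_to_unit_vectors:
  fixes D :: "(real ^ 'n) set"
  assumes "span D = UNIV" "v \<noteq> 0"
  obtains f :: "real ^ 'n \<Rightarrow> real ^ 'n" and z
  where "linear f" "inj f" "f v = unit z" "\<And>i. i \<noteq> z \<Longrightarrow> unit i \<in> f ` D"
proof -
  obtain E where E: "v \<in> E" "E \<subseteq> insert v D" "independent E" "card E = CARD('n)"
    using ex_basis_in_spanning_set[OF assms] by auto
  then obtain g where g: "bij_betw g (UNIV :: 'n set) E"
    using finite_same_card_bij[of "UNIV :: 'n set" E] independent_imp_finite by auto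
  obtain f where f: "linear f" "\<And>x. x \<in> E \<Longrightarrow> f x = unit (inv_into UNIV g x)"
    using linear_independent_extend[OF E(3), of "\<lambda>x. unit (inv_into UNIV g x)"] by blast
  have f_g: "f (g i) = unit i" for i
    using g f(2)[of "g i"] by (auto simp: bij_betw_def inv_into_f_f)
  have "Basis \<subseteq> range f"
  proof
    fix u :: "real ^ 'n" assume "u \<in> Basis"
    then obtain i where "u = unit i" by (auto simp: Basis_vec_def)
    then show "u \<in> range f" using f_g by (metis rangeI)
  qed
  then have "span Basis \<subseteq> range f"
    using f(1) by (intro span_minimal) (auto intro: linear_subspace_image)
  then have inj: "inj f" using f(1) linear_surjective_imp_injective by auto
  obtain z where g_z: "g z = v" using g E(1) by (metis bij_betw_imp_surj_on imageE)
  show thesis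
  proof (rule that[OF f(1) inj])
    show "f v = unit z" using f_g g_z by blast
    fix i assume "i \<noteq> z"
    then have "g i \<noteq> v" using g g_z by (metis bij_betw_imp_inj_on inj_eq)
    then have "g i \<in> D" using g E(2) by (auto simp: bij_betw_def)
    then show "unit i \<in> f ` D" using f_g by (metis imageI)
  qed
qed

lemma has_unit_edge_linear_image:
  assumes "linear f" "unit i \<in> f ` differences A"
  shows "has_unit_edge {} i (f ` A)"
proof -
  obtain x y where "x \<in> A" "y \<in> A" "unit i = f x - f y"
    using assms by (auto simp: differences_def linear_diff)
  then have "f y \<in> f ` A" "f y + unit i \<in> f ` A" by auto
  then show ?thesis unfolding has_unit_edge_def by blast
qed

lemma ex_lattice_pair:
  fixes A B :: "(real ^ 'n) set"
  assumes fin: "finite A" "finite B" and dim: "aff_dim (A + B) = int CARD('n)" and v_nz: "v \<noteq> 0"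
  obtains z :: 'n and A' B' where "reduces_to v A B (unit z) A' B'" "lattice_pair z {} A' B'"
proof -
  have "span (differences A \<union> differences B) = UNIV"
    using dim by (intro span_differences_eq_UNIV) simp
  then obtain f :: "real ^ 'n \<Rightarrow> real ^ 'n" and z where f: "linear f" "inj f" "f v = unit z"
    and unit_image: "\<And>i. i \<noteq> z \<Longrightarrow> unit i \<in> f ` (differences A \<union> differences B)"
    using ex_linear_to_unit_vectors[OF _ v_nz] by metis
  have "has_unit_edge {} i (f ` A) \<or> has_unit_edge {} i (f ` B)" if "i \<noteq> z" for i
    using unit_image[OF that] has_unit_edge_linear_image[OF f(1)] by (auto simp: image_Un)
  moreover have "A \<noteq> {}" "B \<noteq> {}" using dim by (auto simp: set_plus_def)
  ultimately obtain A' B' where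
    "reduces_to (unit z) (f ` A) (f ` B) (unit z) A' B'" "lattice_pair z {} A' B'"
    using ex_lattice_pair_if_unit_edges[of "f ` A" "f ` B" z] fin by auto
  moreover have "reduces_to v A B (unit z) (f ` A) (f ` B)"
    using reduces_to_linear_image[OF f(1,2) v_nz] f(3) by simp
  ultimately show thesis using that reduces_to_trans by blast
qed

section \<open>Pairs that are stable under compression\<close>

lemma lattice_pair_compress:
  assumes w_admissible: "w $ k = 1" "w $ z = 0" "\<And>i. i \<noteq> k \<Longrightarrow> - w $ i \<in> \<nat>"
    and pair: "lattice_pair z S A B"
    and keeps_unit: "unit k \<in> A \<and> unit k - w \<in> A \<or> unit k \<in> B \<and> unit k - w \<in> B" "k \<in> S \<Longrightarrow> w = unit k"
  shows "lattice_pair z S (coord_compress k w A) (coord_compress k w B)"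
proof -
  interpret coord_compression k w by (rule coord_compressionI) fact
  have fin: "finite A" "finite B" using lattice_pair_finite[OF pair] by auto
  have "unit i \<in> compress A \<union> compress B" if "i \<noteq> z" for i
    using that pair keeps_unit(1) fin unit_mem_compress height_unit_mem_compress
    unfolding lattice_pair_def by (cases "i = k") blast+
  moreover have "unit i \<in> compress A \<inter> compress B" if "i \<in> S" for i
  proof (cases "i = k")
    case True
    then have "unit k - w = 0" using keeps_unit(2) that by simp
    then show ?thesis
      using that pair fin True height_unit_mem_compress by (auto simp: lattice_pair_def)
  next
    case False
    then show ?thesis using that pair fin unit_mem_compress by (auto simp: lattice_pair_def)
  qed
  moreover have "compress A \<union> compress B \<subseteq> nat_vectors"
    using pair fin compress_subset_nat_vectors[OF w_admissible(3)] by (simp add: lattice_pair_def)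
  ultimately show ?thesis
    using pair fin stacked_compress[OF w_admissible(2)] zero_mem_compress
    unfolding lattice_pair_def by blast
qed

lemma sum_in_Nats: "(\<And>x. x \<in> X \<Longrightarrow> f x \<in> \<nat>) \<Longrightarrow> sum f X \<in> \<nat>"
  by (induction X rule: infinite_finite_induct) auto

lemma ex_compression_stable_pair:
  fixes \<phi> :: "real ^ 'n \<Rightarrow> real"
  assumes functional: "linear \<phi>" "\<And>x. x \<in> nat_vectors \<Longrightarrow> \<phi> x \<in> \<nat>"
    and Q_lattice: "\<And>A B. Q A B \<Longrightarrow> finite A \<and> finite B \<and> A \<union> B \<subseteq> nat_vectors" and initial: "Q A0 B0"
  obtains A B where "Q A B"
    "\<And>k w. w $ k = 1 \<Longrightarrow> \<phi> w > 0 \<Longrightarrow> Q (coord_compress k w A) (coord_compress k w B) \<Longrightarrow>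
      coord_compress k w A = A \<and> coord_compress k w B = B"
proof -
  define \<Phi> where "\<Phi> P = sum \<phi> (fst P) + sum \<phi> (snd P)" for P
  have \<Phi>_Nats: "\<Phi> (A, B) \<in> \<nat>" if "Q A B" for A B
    unfolding \<Phi>_def using Q_lattice[OF that] functional(2) by (auto intro!: Nats_add sum_in_Nats)
  obtain P where "Q (fst P) (snd P)"
    and least: "\<And>P'. Q (fst P') (snd P') \<Longrightarrow> nat \<lfloor>\<Phi> P\<rfloor> \<le> nat \<lfloor>\<Phi> P'\<rfloor>"
    using ex_has_least_nat[of "\<lambda>P. Q (fst P) (snd P)" "(A0, B0)" "\<lambda>P. nat \<lfloor>\<Phi> P\<rfloor>"] initial by auto
  then obtain A B where P_eq: "P = (A, B)" and Q_AB: "Q A B" by (cases P) auto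
  have minimal: "\<Phi> (A, B) \<le> \<Phi> (A', B')" if "Q A' B'" for A' B'
    using least[of "(A', B')"] that \<Phi>_Nats[OF that] \<Phi>_Nats[OF Q_AB] P_eq by (auto elim!: Nats_cases)
  have "coord_compress k w A = A \<and> coord_compress k w B = B"
    if w_admissible: "w $ k = 1" "\<phi> w > 0"
      and compressed: "Q (coord_compress k w A) (coord_compress k w B)" for k w
  proof -
    interpret coord_compression k w by (rule coord_compressionI) fact
    have A_nat: "finite A" "\<And>x. x \<in> A \<Longrightarrow> x $ k \<in> \<nat>" and B_nat: "finite B" "\<And>x. x \<in> B \<Longrightarrow> x $ k \<in> \<nat>"
      using Q_lattice[OF Q_AB] nat_vectors_nth by blast+
    have "sum \<phi> A + sum \<phi> B \<le> sum \<phi> (compress A) + sum \<phi> (compress B)"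
      using minimal[OF compressed] by (simp add: \<Phi>_def)
    moreover have "sum \<phi> (compress A) \<le> sum \<phi> A" "sum \<phi> (compress B) \<le> sum \<phi> B"
      using sum_compress_le[OF A_nat functional(1) w_admissible(2)]
        sum_compress_le[OF B_nat functional(1) w_admissible(2)] by auto
    ultimately have "sum \<phi> (compress A) = sum \<phi> A" "sum \<phi> (compress B) = sum \<phi> B" by linarith+
    then show ?thesis
      using compress_eq_self_if_sum_eq[OF A_nat functional(1) w_admissible(2)]
        compress_eq_self_if_sum_eq[OF B_nat functional(1) w_admissible(2)]
      by blast
  qed
  then show thesis using that Q_AB by blast
qed

definition exchange_closed :: "'n \<Rightarrow> 'n \<Rightarrow> nat \<Rightarrow> (real ^ 'n) set \<Rightarrow> bool" where
  "exchange_closed k c n A \<longleftrightarrow> (\<forall>x\<in>A. x $ k \<ge> 1 \<longrightarrow> x - unit k + real n *\<^sub>R unit c \<in> A)"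

lemma exchange_closed_if_compress_eq_self:
  assumes "c \<noteq> k \<or> n = 0" "finite A" "coord_compress k (unit k - real n *\<^sub>R unit c) A = A"
  shows "exchange_closed k c n A"
proof -
  interpret coord_compression k "unit k - real n *\<^sub>R unit c"
    using assms(1) by (intro coord_compressionI) (auto simp: unit_nth)
  show ?thesis
    using compress_diff_mem[OF assms(2)] assms(3) by (simp add: exchange_closed_def algebra_simps)
qed

lemma down_setI_exchange:
  assumes "stacked z A" "A \<subseteq> nat_vectors" "\<And>k. k \<noteq> z \<Longrightarrow> exchange_closed k z 0 A"
  shows "down_set A"
proof (rule down_setI[OF assms(2)])
  show "x - unit k \<in> A" if "x \<in> A" "x $ k \<ge> 1" for x k
    using that assms(1) assms(3)[of k]
    by (cases "k = z") (auto simp: stacked_def exchange_closed_def)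
qed

lemma exchange_compress:
  assumes pair: "lattice_pair z S A B" and k_neq_z: "k \<noteq> z"
    and exchangeable: "n = 0 \<or> k \<notin> S \<and> c \<noteq> z \<and> c \<noteq> k"
    and mem: "unit k \<in> A \<and> real n *\<^sub>R unit c \<in> A \<or> unit k \<in> B \<and> real n *\<^sub>R unit c \<in> B"
  defines "w \<equiv> unit k - real n *\<^sub>R unit c"
  shows "w $ k = 1"
    and "reduces_to (unit z) A B (unit z) (coord_compress k w A) (coord_compress k w B)"
    and "lattice_pair z S (coord_compress k w A) (coord_compress k w B)"
proof -
  have w_nths: "w $ k = 1" "w $ z = 0" using k_neq_z exchangeable by (auto simp: w_def unit_nth)
  show "w $ k = 1" by (rule w_nths(1))
  show "lattice_pair z S (coord_compress k w A) (coord_compress k w B)"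
    using exchangeable mem
    by (intro lattice_pair_compress[OF w_nths _ pair]) (auto simp: w_def unit_nth)
  interpret coord_compression k w by (intro coord_compressionI w_nths(1))
  show "reduces_to (unit z) A B (unit z) (compress A) (compress B)"
    using pair
    by (intro reduces_to_compress_transversal[OF w_nths(2)]) (auto simp: lattice_pair_def)
qed

definition weighted_sum :: "('n::finite \<Rightarrow> nat) \<Rightarrow> real ^ 'n \<Rightarrow> real" where
  "weighted_sum weight x = (\<Sum>i\<in>UNIV. weight i * x $ i)"

lemma linear_weighted_sum: "linear (weighted_sum weight)"
  unfolding weighted_sum_def
  by (rule linearI) (simp_all add: sum.distrib sum_distrib_left algebra_simps)

lemma weighted_sum_Nats: "x \<in> nat_vectors \<Longrightarrow> weighted_sum weight x \<in> \<nat>"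
  unfolding weighted_sum_def by (intro sum_in_Nats Nats_mult of_nat_in_Nats nat_vectors_nth)

lemma weighted_sum_unit: "weighted_sum weight (unit k) = weight k"
  unfolding weighted_sum_def by (simp add: unit_nth if_distrib cong: if_cong)

lemma ex_stable_lattice_pair:
  fixes weight :: "'n::finite \<Rightarrow> nat"
  assumes initial: "lattice_pair z S A0 B0" and weight: "\<And>i. i \<noteq> z \<Longrightarrow> weight i > 0"
  obtains A B where "reduces_to (unit z) A0 B0 (unit z) A B" "lattice_pair z S A B"
    "down_set A" "down_set B"
    "\<And>k c n. k \<noteq> z \<Longrightarrow> k \<notin> S \<Longrightarrow> c \<noteq> z \<Longrightarrow> c \<noteq> k \<Longrightarrow> n * weight c < weight k \<Longrightarrow>
      unit k \<in> A \<and> real n *\<^sub>R unit c \<in> A \<or> unit k \<in> B \<and> real n *\<^sub>R unit c \<in> B \<Longrightarrow>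
      exchange_closed k c n A \<and> exchange_closed k c n B"
proof -
  define Q where "Q A B \<longleftrightarrow> reduces_to (unit z) A0 B0 (unit z) A B \<and> lattice_pair z S A B" for A B
  have Q_finite: "finite A \<and> finite B \<and> A \<union> B \<subseteq> nat_vectors" if "Q A B" for A B
    using that lattice_pair_finite by (auto simp: Q_def lattice_pair_def)
  have "Q A0 B0" using initial by (simp add: Q_def reduces_to_refl)
  then obtain A B where Q_AB: "Q A B" and stable: "\<And>k w. w $ k = 1 \<Longrightarrow> weighted_sum weight w > 0 \<Longrightarrow>
      Q (coord_compress k w A) (coord_compress k w B) \<Longrightarrow>
      coord_compress k w A = A \<and> coord_compress k w B = B"
    using ex_compression_stable_pair[of _ Q, OF linear_weighted_sum weighted_sum_Nats Q_finite]
    by metis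
  then have pair: "lattice_pair z S A B" by (simp add: Q_def)
  have exchange: "exchange_closed k c n A \<and> exchange_closed k c n B"
    if k_neq_z: "k \<noteq> z" and exchangeable: "n = 0 \<or> k \<notin> S \<and> c \<noteq> z \<and> c \<noteq> k"
      and lighter: "n * weight c < weight k"
      and mem: "unit k \<in> A \<and> real n *\<^sub>R unit c \<in> A \<or> unit k \<in> B \<and> real n *\<^sub>R unit c \<in> B" for k c n
  proof -
    let ?w = "unit k - real n *\<^sub>R unit c"
    have "weighted_sum weight ?w = real (weight k) - real (n * weight c)"
      by (simp add: linear_diff[OF linear_weighted_sum] linear_scale[OF linear_weighted_sum]
          weighted_sum_unit)
    then have pos: "weighted_sum weight ?w > 0"
      using lighter by (simp only: of_nat_less_iff diff_gt_0_iff_gt)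
    have "Q (coord_compress k ?w A) (coord_compress k ?w B)"
      using Q_AB exchange_compress(2,3)[OF pair k_neq_z exchangeable mem] reduces_to_trans
      unfolding Q_def by blast
    then have "coord_compress k ?w A = A \<and> coord_compress k ?w B = B"
      using stable[OF exchange_compress(1)[OF pair k_neq_z exchangeable mem] pos] by blast
    then show ?thesis
      using exchange_closed_if_compress_eq_self exchangeable lattice_pair_finite[OF pair] by blast
  qed
  have "exchange_closed k z 0 A \<and> exchange_closed k z 0 B" if "k \<noteq> z" for k
    using pair that weight by (intro exchange) (auto simp: lattice_pair_def)
  then have "down_set A" "down_set B"
    using pair by (auto simp: lattice_pair_def intro!: down_setI_exchange)
  then show thesis
    using Q_AB exchange by (intro that[of A B]) (auto simp: Q_def)
qed

section \<open>Sumsets of combs\<close>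

lemma lattice_path_mean_step:
  fixes P Q S T \<alpha> \<beta> X :: real
  assumes pos: "P > 0" "Q > 0"
    and horizontal: "(P + Q) * (S / P + (T + \<beta>) / (Q + 1)) \<le> X"
    and vertical: "(P + Q) * ((S + \<alpha>) / (P + 1) + T / Q) \<le> X"
  shows "(P + Q + 1) * ((S + \<alpha>) / (P + 1) + (T + \<beta>) / (Q + 1)) \<le> X + (\<alpha> + \<beta>)"
proof -
  let ?h = "S / P + (T + \<beta>) / (Q + 1)" and ?v = "(S + \<alpha>) / (P + 1) + T / Q"
  have "P * h + Q * v \<le> X" if "(P + Q) * h \<le> X" "(P + Q) * v \<le> X" for h v
  proof -
    have "(P + Q) * (P * h + Q * v) = P * ((P + Q) * h) + Q * ((P + Q) * v)"
      by (simp add: algebra_simps)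
    also have "\<dots> \<le> P * X + Q * X"
      using that pos by (intro add_mono mult_left_mono) auto
    also have "\<dots> = (P + Q) * X" by (simp add: algebra_simps)
    finally show ?thesis using pos by (simp add: mult_le_cancel_left)
  qed
  from this[OF horizontal vertical] have average: "P * ?h + Q * ?v \<le> X" .
  have "(P + Q + 1) * ((S + \<alpha>) / (P + 1)) = S + \<alpha> + Q * ((S + \<alpha>) / (P + 1))"
    "(P + Q + 1) * ((T + \<beta>) / (Q + 1)) = T + \<beta> + P * ((T + \<beta>) / (Q + 1))"
    "P * (S / P) = S" "Q * (T / Q) = T"
    using pos by (simp_all add: field_simps)
  then have "(P + Q + 1) * ((S + \<alpha>) / (P + 1) + (T + \<beta>) / (Q + 1)) = P * ?h + Q * ?v + (\<alpha> + \<beta>)"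
    by (simp only: distrib_left)
  then show ?thesis using average by simp
qed

text \<open>The right-hand side dominates the sum of \<open>a i + b j\<close> over every monotone lattice path from
  \<open>(0, 0)\<close> to \<open>(p, q)\<close>; a random path whose last step is horizontal with probability
  \<open>p / (p + q)\<close> visits each row and each column equally often on average.\<close>

lemma lattice_path_mean_le:
  fixes a b m :: "nat \<Rightarrow> real"
  assumes "\<And>i j. i \<le> p \<Longrightarrow> j \<le> q \<Longrightarrow> a i + b j \<le> m (i + j)"
  shows "(real p + real q + 1) * ((\<Sum>i\<le>p. a i) / (real p + 1) + (\<Sum>j\<le>q. b j) / (real q + 1))
    \<le> (\<Sum>n\<le>p + q. m n)"
  using assms
proof (induction "p + q" arbitrary: p q rule: less_induct)
  case less
  consider (column) "p = 0" | (row) "q = 0" | (rectangle) p' q' where "p = Suc p'" "q = Suc q'"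
    by (metis not0_implies_Suc)
  then show ?case
  proof cases
    case column
    have "(\<Sum>j\<le>q. a 0 + b j) \<le> (\<Sum>j\<le>q. m j)" using less.prems[of 0] column by (intro sum_mono) auto
    then show ?thesis by (simp add: column sum.distrib distrib_left add.commute)
  next
    case row
    have "(\<Sum>i\<le>p. a i + b 0) \<le> (\<Sum>i\<le>p. m i)" using less.prems[of _ 0] row by (intro sum_mono) auto
    then show ?thesis by (simp add: row sum.distrib distrib_left add.commute)
  next
    case rectangle
    have "(real p + real q + 1) * ((\<Sum>i\<le>p. a i) / (real p + 1) + (\<Sum>j\<le>q. b j) / (real q + 1))
        \<le> (\<Sum>n\<le>Suc (p' + q'). m n) + (a p + b q)"
      using lattice_path_mean_step[of "real p' + 1" "real q' + 1" "sum a {..p'}" "sum b {..q'}"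
          "b q" "\<Sum>n\<le>Suc (p' + q'). m n" "a p"]
        less.hyps[of p' q] less.hyps[of p q'] less.prems rectangle
      by (simp add: algebra_simps)
    also have "\<dots> \<le> (\<Sum>n\<le>p + q. m n)" using less.prems[of p q] rectangle by simp
    finally show ?thesis .
  qed
qed

definition comb_base :: "'n \<Rightarrow> nat \<Rightarrow> 'n set \<Rightarrow> (real ^ 'n) set" where
  "comb_base c p I = (\<lambda>n. real n *\<^sub>R unit c) ` {..p} \<union> unit ` I"

lemma inj_scaled_unit: "inj (\<lambda>n. real n *\<^sub>R unit c :: real ^ 'n)"
  by (rule injI) (auto simp: axis_eq_axis dest!: scaleR_right_imp_eq)

lemma scaled_unit_neq_unit: "k \<noteq> c \<Longrightarrow> real n *\<^sub>R unit c \<noteq> (unit k :: real ^ 'n)"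
  by (metis axis_nth unit_nth_other vector_scaleR_component mult_zero_right zero_neq_one
      real_scaleR_def)

lemma unit_mem_comb_base: "k \<noteq> c \<Longrightarrow> unit k \<in> comb_base c p I \<longleftrightarrow> k \<in> I"
  using scaled_unit_neq_unit[of k c] by (force simp: comb_base_def axis_eq_axis)

lemma comb_base_insert: "comb_base c p (insert k I) = insert (unit k) (comb_base c p I)"
  by (simp add: comb_base_def)

lemma comb_base_nth: "u \<in> comb_base c p I \<Longrightarrow> k \<notin> I \<Longrightarrow> k \<noteq> c \<Longrightarrow> u $ k = 0"
  by (auto simp: comb_base_def unit_nth)

lemma card_comb_base:
  fixes I :: "'n::finite set"
  assumes "c \<notin> I" shows "card (comb_base c p I) = p + 1 + card I"
proof -
  have "card ((\<lambda>n. real n *\<^sub>R unit c :: real ^ 'n) ` {..p}) = p + 1"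
    using inj_scaled_unit by (subst card_image) (auto intro: inj_on_subset)
  moreover have "card ((unit :: 'n \<Rightarrow> real ^ 'n) ` I) = card I"
    by (intro card_image) (auto simp: inj_on_def axis_eq_axis)
  moreover have "real n *\<^sub>R unit c \<noteq> (unit k :: real ^ 'n)" if "k \<in> I" for n k
    using that assms by (intro scaled_unit_neq_unit) auto
  then have "(\<lambda>n. real n *\<^sub>R unit c :: real ^ 'n) ` {..p} \<inter> unit ` I = {}" by auto
  ultimately show ?thesis unfolding comb_base_def by (subst card_Un_disjoint) auto
qed

locale comb = axis_compression z for z :: "'n::finite" +
  fixes c :: 'n and A :: "(real ^ 'n) set" and p :: nat and I :: "'n set"
  assumes z_neq_c: "z \<noteq> c" and finite_A: "finite A" and I_subset: "I \<subseteq> - {z, c}"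
    and base_A: "base ` A = comb_base c p I"
begin

definition part :: "'n set \<Rightarrow> (real ^ 'n) set" where
  "part K = {x \<in> A. base x \<in> comb_base c p (I \<inter> K)}"

lemma finite_part [simp]: "finite (part K)"
  using finite_A by (simp add: part_def)

lemma finite_fibre_A [simp]: "finite (fibre A u)"
  using finite_A by simp

lemma line_count_eq: "line_count (unit z) A = p + 1 + card I"
  unfolding line_count_eq_card_base base_A
  using I_subset by (intro card_comb_base) auto

lemma fibre_unit_empty_iff: "k \<noteq> c \<Longrightarrow> fibre A (unit k) = {} \<longleftrightarrow> k \<notin> I"
  by (simp add: fibre_eq_empty_iff base_A unit_mem_comb_base)

lemma base_part: "base ` part K = comb_base c p (I \<inter> K)"
proof -
  have "comb_base c p (I \<inter> K) \<subseteq> base ` A" unfolding base_A by (auto simp: comb_base_def)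
  then show ?thesis by (auto simp: part_def)
qed

lemma card_base_part: "card (base ` part K) = p + 1 + card (I \<inter> K)"
  unfolding base_part using I_subset by (intro card_comb_base) auto

lemma part_eq_self: "I \<subseteq> K \<Longrightarrow> part K = A"
  using base_A by (auto simp: part_def Int_absorb2)

lemma part_nth: "x \<in> part K \<Longrightarrow> k \<notin> K \<Longrightarrow> k \<noteq> z \<Longrightarrow> k \<noteq> c \<Longrightarrow> x $ k = 0"
  using comb_base_nth[of "base x" c p "I \<inter> K" k] by (simp add: part_def base_nth_other)

lemma part_insert: "k \<noteq> c \<Longrightarrow> part (insert k K) = part K \<union> fibre A (unit k)"
  using fibre_unit_empty_iff[of k]
  by (cases "k \<in> I") (auto simp: part_def fibre_def comb_base_insert)

lemma card_part_insert:
  assumes "k \<notin> K" "k \<noteq> z" "k \<noteq> c"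
  shows "card (part (insert k K)) = card (part K) + card (fibre A (unit k))"
proof -
  have "part K \<inter> fibre A (unit k) = {}"
    using part_nth[OF _ assms] fibre_unit_nth[OF _ assms(2)] by fastforce
  then show ?thesis by (simp add: part_insert assms card_Un_disjoint)
qed

end

text \<open>The coefficient of \<open>|A|\<close> when a pair of combs is restricted to the teeth in \<open>K\<close>: a tooth
  of \<open>B\<close> alone contributes another copy of \<open>A\<close>, a common tooth only half a copy.\<close>

definition comb_weight :: "nat \<Rightarrow> nat \<Rightarrow> 'n set \<Rightarrow> 'n set \<Rightarrow> 'n set \<Rightarrow> real" where
  "comb_weight p q I J K =
    (real p + real q + 1) / (real p + 1) + card (K \<inter> J - I) + card (K \<inter> I \<inter> J) / 2"

lemma comb_weight_insert:
  assumes "finite K" "k \<notin> K"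
  shows "k \<in> I - J \<Longrightarrow> comb_weight p q I J (insert k K) = comb_weight p q I J K"
    and "k \<in> J - I \<Longrightarrow> comb_weight p q I J (insert k K) = comb_weight p q I J K + 1"
    and "k \<in> I \<inter> J \<Longrightarrow> comb_weight p q I J (insert k K) = comb_weight p q I J K + 1 / 2"
  using assms by (auto simp: comb_weight_def Int_insert_left insert_Diff_if add_divide_distrib)

lemma comb_weight_ge_one: "comb_weight p q I J K \<ge> 1"
  unfolding comb_weight_def by (simp add: field_simps)

lemma comb_weight_le:
  assumes "finite K" shows "comb_weight p q I J K \<le> real (q + 1 + card (J \<inter> K))"
proof -
  have "(real p + real q + 1) / (real p + 1) \<le> real q + 1" by (simp add: field_simps)
  moreover have "card (J \<inter> K) = card (K \<inter> J - I) + card (K \<inter> I \<inter> J)"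
    using assms by (subst card_Un_disjoint[symmetric]) (auto intro: arg_cong[where f = card])
  ultimately show ?thesis unfolding comb_weight_def by simp
qed

lemma comb_weight_common_le:
  assumes "K \<subseteq> I \<inter> J"
  shows "comb_weight p p I J K + 1 / 2 \<le> (real p + 1 + card K) / 2 + 1"
proof -
  have "real p * (real p - 1) \<ge> 0" by (cases p) auto
  then have "(2 * real p + 1) / (real p + 1) \<le> (real p + 1) / 2 + 1 / 2" by (simp add: field_simps)
  moreover have "card (K \<inter> J - I) = 0" "card (K \<inter> I \<inter> J) = card K"
    using assms
    by (auto simp: Int_absorb2 intro: arg_cong[where f = card] card_eq_0_iff[THEN iffD2])
  ultimately show ?thesis by (simp add: comb_weight_def add_divide_distrib)
qed

locale comb_pair = axis_compression z + A: comb z c A p I + B: comb z c B q J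
  for z c :: "'n::finite" and A p I B q J +
  assumes cover: "I \<union> J = - {z, c}" and balanced: "I \<inter> J \<noteq> {} \<Longrightarrow> p = q"
begin

lemma comb_pair_swap: "comb_pair z c B q J A p I"
  using cover balanced by unfold_locales auto

lemma card_core_plus_ge:
  "(real p + real q + 1) * (card (A.part {}) / (real p + 1) + card (B.part {}) / (real q + 1) - 1)
    \<le> card (A.part {} + B.part {})"
proof -
  define u where "u n = (real n *\<^sub>R unit c :: real ^ 'n)" for n
  have inj: "inj_on u N" for N
    unfolding u_def by (rule inj_on_subset[OF inj_scaled_unit]) simp
  let ?S = "A.part {} + B.part {}"
  have finS: "finite ?S" by (simp add: finite_set_plus)
  have A_core: "A.part {} = {x \<in> A. base x \<in> u ` {..p}}"
    and B_core: "B.part {} = {x \<in> B. base x \<in> u ` {..q}}"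
    by (simp_all add: A.part_def B.part_def comb_base_def u_def)
  have "real (card (fibre A (u i))) + real (card (fibre B (u j)))
      \<le> real (card (fibre ?S (u (i + j)))) + 1"
    if ij: "i \<le> p" "j \<le> q" for i j
  proof -
    have "card (fibre A (u i)) + card (fibre B (u j)) \<le> card (fibre A (u i) + fibre B (u j)) + 1"
    proof (rule card_plus_ge_in_lines[of _ _ "u i" "u j"])
      show "fibre A (u i) \<noteq> {}" "fibre B (u j) \<noteq> {}"
        using ij by (auto simp: fibre_eq_empty_iff A.base_A B.base_A comb_base_def u_def)
    qed (auto simp: fibre_def A.finite_A B.finite_A)
    moreover have "fibre A (u i) + fibre B (u j) \<subseteq> fibre ?S (u (i + j))"
      using ij by (auto simp: A_core B_core fibre_def u_def scaleR_add_left elim!: set_plus_elim)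
    then have "card (fibre A (u i) + fibre B (u j)) \<le> card (fibre ?S (u (i + j)))"
      using finS by (intro card_mono) auto
    ultimately show ?thesis by linarith
  qed
  then have "(real p + real q + 1) * ((\<Sum>i\<le>p. real (card (fibre A (u i)))) / (real p + 1)
      + (\<Sum>j\<le>q. real (card (fibre B (u j)))) / (real q + 1))
      \<le> (\<Sum>n\<le>p + q. real (card (fibre ?S (u n))) + 1)"
    by (rule lattice_path_mean_le)
  moreover have "(\<Sum>i\<le>p. card (fibre A (u i))) = card (A.part {})"
    "(\<Sum>j\<le>q. card (fibre B (u j))) = card (B.part {})"
    unfolding A_core B_core fibre_def by (simp_all add: sum_card_fibres A.finite_A B.finite_A inj)
  moreover have "(\<Sum>n\<le>p + q. card (fibre ?S (u n))) \<le> card ?S"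
    unfolding fibre_def using finS by (subst sum_card_fibres) (auto simp: inj intro!: card_mono)
  ultimately show ?thesis
    by (simp add: sum.distrib algebra_simps flip: of_nat_sum)
qed

definition middle :: "'n \<Rightarrow> 'n set \<Rightarrow> (real ^ 'n) set" where
  "middle k K = (A.part K + fibre B (unit k)) \<union> (fibre A (unit k) + B.part K)"

lemma card_plus_insert_ge:
  assumes k_new: "k \<notin> K" "k \<noteq> z" "k \<noteq> c"
  shows "card (A.part K + B.part K) + card (middle k K) + card (fibre A (unit k) + fibre B (unit k))
    \<le> card (A.part (insert k K) + B.part (insert k K))"
  unfolding A.part_insert[OF k_new(3)] B.part_insert[OF k_new(3)] middle_def
proof (rule card_plus_ge_three_levels)
  show "linear (\<lambda>x :: real ^ 'n. x $ k)" by (rule linearI) simp_all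
  show "x $ k = 0" if "x \<in> A.part K \<union> B.part K" for x
    using that A.part_nth[OF _ k_new] B.part_nth[OF _ k_new] by blast
  show "x $ k = 1" if "x \<in> fibre A (unit k) \<union> fibre B (unit k)" for x
    using that fibre_unit_nth k_new(2) by blast
qed simp_all

lemma card_middle_ge_A_tooth:
  assumes tooth: "k \<in> I"
  shows "card (B.part K) + (q + 1 + card (J \<inter> K)) * card (fibre A (unit k))
    \<le> card (middle k K) + (q + 1 + card (J \<inter> K))"
proof -
  have "card (B.part K) + card (base ` B.part K) * card (fibre A (unit k))
      \<le> card (B.part K + fibre A (unit k)) + card (base ` B.part K)"
    using tooth A.I_subset A.fibre_unit_empty_iff[of k]
    by (intro card_plus_line_ge[of _ _ "unit k"]) (auto simp: fibre_def A.finite_A)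
  moreover have "card (B.part K + fibre A (unit k)) \<le> card (middle k K)"
    unfolding middle_def
    by (intro card_mono) (auto simp: finite_set_plus add.commute[of "B.part K"])
  ultimately show ?thesis by (simp add: B.card_base_part)
qed

lemma card_middle_ge_B_tooth:
  assumes "k \<in> J"
  shows "card (A.part K) + (p + 1 + card (I \<inter> K)) * card (fibre B (unit k))
    \<le> card (middle k K) + (p + 1 + card (I \<inter> K))"
proof -
  have "comb_pair.middle z c B q J A p I k K = middle k K"
    unfolding comb_pair.middle_def[OF comb_pair_swap] middle_def
    by (simp add: Un_commute add.commute)
  then show ?thesis using comb_pair.card_middle_ge_A_tooth[OF comb_pair_swap assms, of K] by simp
qed

definition bounded_on :: "'n set \<Rightarrow> bool" where
  "bounded_on K \<longleftrightarrow>
    comb_weight p q I J K * card (A.part K) + comb_weight q p J I K * card (B.part K)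
      - (real (card K) + 1) * (real (line_count (unit z) A) + real (line_count (unit z) B))
    \<le> card (A.part K + B.part K)"

lemma bounded_on_empty: "bounded_on {}"
proof -
  have "real p + real q + 1 \<le> real (line_count (unit z) A) + real (line_count (unit z) B)"
    by (simp add: A.line_count_eq B.line_count_eq)
  then show ?thesis
    using card_core_plus_ge by (simp add: bounded_on_def comb_weight_def algebra_simps)
qed

lemma bounded_on_insert_A_tooth:
  assumes tooth: "k \<in> I - J" "k \<notin> K" and bounded: "bounded_on K"
  shows "bounded_on (insert k K)"
proof -
  have k_transversal: "k \<noteq> z" "k \<noteq> c" using tooth A.I_subset by auto
  let ?\<mu> = "comb_weight p q I J K" and ?\<nu> = "comb_weight q p J I K"
  let ?a = "real (card (A.part K))" and ?b = "real (card (B.part K))" and ?s = "real (card K)"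
  let ?a' = "real (card (fibre A (unit k)))" and ?m = "real (card (middle k K))"
  let ?E = "real (line_count (unit z) A) + real (line_count (unit z) B)"
  define R where "R = q + 1 + card (J \<inter> K)"
  have "R \<le> line_count (unit z) B"
    unfolding R_def B.line_count_eq by (intro add_left_mono card_mono) auto
  then have R_bound: "real R \<le> ?E" by simp
  have "?\<mu> * ?a' \<le> real R * ?a'"
    unfolding R_def by (intro mult_right_mono comb_weight_le) simp_all
  moreover have
    "real (card (B.part K) + R * card (fibre A (unit k))) \<le> real (card (middle k K) + R)"
    using card_middle_ge_A_tooth[of k K] tooth(1) by (simp only: R_def of_nat_le_iff Diff_iff)
  then have "?b + real R * ?a' \<le> ?m + real R" by simp
  moreover have "real (card (A.part K + B.part K)) + ?m
      \<le> real (card (A.part (insert k K) + B.part (insert k K)))"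
    using card_plus_insert_ge[OF tooth(2) k_transversal] by linarith
  moreover have "?\<mu> * (?a + ?a') + (?\<nu> + 1) * ?b - (?s + 1 + 1) * ?E
      = (?\<mu> * ?a + ?\<nu> * ?b - (?s + 1) * ?E) + ?\<mu> * ?a' + ?b - ?E"
    by (simp add: algebra_simps)
  ultimately have "?\<mu> * (?a + ?a') + (?\<nu> + 1) * ?b - (?s + 1 + 1) * ?E
      \<le> real (card (A.part (insert k K) + B.part (insert k K)))"
    using bounded R_bound unfolding bounded_on_def by linarith
  moreover have "fibre B (unit k) = {}"
    using tooth k_transversal by (simp add: B.fibre_unit_empty_iff)
  then have "card (B.part (insert k K)) = card (B.part K)"
    using tooth k_transversal by (simp add: B.card_part_insert)
  ultimately show ?thesis
    using tooth k_transversal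
    by (simp add: bounded_on_def comb_weight_insert A.card_part_insert add.commute add.left_commute)
qed

lemma bounded_on_insert_B_tooth:
  assumes "k \<in> J - I" "k \<notin> K" "bounded_on K"
  shows "bounded_on (insert k K)"
proof -
  have "comb_pair.bounded_on z c B q J A p I K \<longleftrightarrow> bounded_on K" for K
    unfolding comb_pair.bounded_on_def[OF comb_pair_swap] bounded_on_def by (simp add: add.commute)
  then show ?thesis using comb_pair.bounded_on_insert_A_tooth[OF comb_pair_swap] assms by blast
qed

lemma card_middle_ge_common_tooth:
  assumes tooth: "k \<in> I \<inter> J" and common: "K \<subseteq> I \<inter> J"
  shows "(real (card (A.part K)) + card (B.part K)
      + (real p + 1 + card K) * (real (card (fibre A (unit k))) + card (fibre B (unit k)) - 2)) / 2
    \<le> card (middle k K)"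
proof -
  have p_eq_q: "q = p" using balanced tooth by auto
  have Int_K: "I \<inter> K = K" "J \<inter> K = K" using common by auto
  have "real (card (A.part K) + (p + 1 + card K) * card (fibre B (unit k)))
      \<le> real (card (middle k K) + (p + 1 + card K))"
    using card_middle_ge_B_tooth[of k K] tooth by (simp only: of_nat_le_iff Int_K Int_iff)
  moreover have "real (card (B.part K) + (p + 1 + card K) * card (fibre A (unit k)))
      \<le> real (card (middle k K) + (p + 1 + card K))"
    using card_middle_ge_A_tooth[of k K] tooth by (simp only: of_nat_le_iff Int_K Int_iff p_eq_q)
  ultimately show ?thesis by (simp add: algebra_simps)
qed

lemma card_common_teeth_plus_ge:
  assumes "k \<in> I \<inter> J"
  shows "card (fibre A (unit k)) + card (fibre B (unit k))
    \<le> card (fibre A (unit k) + fibre B (unit k)) + 1"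
  using assms A.I_subset A.fibre_unit_empty_iff[of k] B.fibre_unit_empty_iff[of k]
  by (intro card_plus_ge_in_lines[of _ _ "unit k" "unit k"])
    (auto simp: fibre_def A.finite_A B.finite_A)

text \<open>A common tooth gains only the mean of the two possible contributions; this suffices as long as
  there are no other teeth, so the common teeth have to be added first.\<close>

lemma bounded_on_insert_common_tooth:
  assumes tooth: "k \<in> I \<inter> J" "k \<notin> K" and common: "K \<subseteq> I \<inter> J" "bounded_on K"
  shows "bounded_on (insert k K)"
proof -
  have k_transversal: "k \<noteq> z" "k \<noteq> c" using tooth A.I_subset by auto
  have p_eq_q: "q = p" using balanced tooth by auto
  let ?a = "real (card (A.part K))" and ?b = "real (card (B.part K))" and ?s = "real (card K)"
  let ?a' = "real (card (fibre A (unit k)))" and ?b' = "real (card (fibre B (unit k)))"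
  let ?m = "real (card (middle k K))" and ?t = "real (card (fibre A (unit k) + fibre B (unit k)))"
  let ?R = "real p + 1 + ?s" and ?E = "real (line_count (unit z) A) + real (line_count (unit z) B)"
  let ?\<mu> = "comb_weight p q I J K"
  have "K \<inter> J - I = {}" "K \<inter> I - J = {}" "K \<inter> I \<inter> J = K \<inter> J \<inter> I" using common(1) by auto
  then have weights_eq: "comb_weight q p J I K = ?\<mu>" by (simp only: comb_weight_def p_eq_q)
  have "card K \<le> card I" using common by (intro card_mono) auto
  then have R_bound: "?R + 1 \<le> ?E" by (simp add: A.line_count_eq B.line_count_eq)
  have weight_le: "(?\<mu> + 1 / 2) * (?a' + ?b') \<le> (?R / 2 + 1) * (?a' + ?b')"
    using comb_weight_common_le[OF common(1), of p] by (intro mult_right_mono) (auto simp: p_eq_q)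
  have "(?\<mu> + 1 / 2) * (?a + ?a') + (?\<mu> + 1 / 2) * (?b + ?b') - (?s + 1 + 1) * ?E
     = (?\<mu> * ?a + ?\<mu> * ?b - (?s + 1) * ?E) + (?a + ?b) / 2 + (?\<mu> + 1 / 2) * (?a' + ?b') - ?E"
    by (simp add: algebra_simps)
  also have "\<dots> \<le> real (card (A.part K + B.part K)) + (?a + ?b) / 2
      + (?R / 2 + 1) * (?a' + ?b') - (?R + 1)"
    using common(2) weight_le R_bound unfolding bounded_on_def weights_eq by linarith
  also have "\<dots> = real (card (A.part K + B.part K)) + (?a + ?b + ?R * (?a' + ?b' - 2)) / 2
      + (?a' + ?b' - 1)"
    by (simp add: field_simps)
  also have "\<dots> \<le> real (card (A.part K + B.part K)) + ?m + ?t"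
    using card_middle_ge_common_tooth[OF tooth(1) common(1)] card_common_teeth_plus_ge[OF tooth(1)]
    by linarith
  also have "\<dots> \<le> real (card (A.part (insert k K) + B.part (insert k K)))"
    using card_plus_insert_ge[OF tooth(2) k_transversal] by linarith
  finally show ?thesis
    using tooth k_transversal
    by (simp add: bounded_on_def comb_weight_insert A.card_part_insert B.card_part_insert
        weights_eq add.commute add.left_commute)
qed

lemma bounded_on_common_teeth: "bounded_on (I \<inter> J)"
proof -
  have "bounded_on K" if "K \<subseteq> I \<inter> J" for K
    using finite[of K] that
    by (induction K rule: finite_induct)
      (auto intro: bounded_on_empty bounded_on_insert_common_tooth)
  then show ?thesis by blast
qed

lemma bounded_on_all_teeth: "bounded_on (- {z, c})"
proof -
  have "bounded_on (I \<inter> J \<union> K)" if "K \<subseteq> - {z, c}" for K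
    using finite[of K] that
  proof (induction K rule: finite_induct)
    case (insert k K)
    have "insert k (I \<inter> J \<union> K) = I \<inter> J \<union> insert k K" by blast
    moreover have "k \<in> I \<union> J" using insert.prems cover by blast
    ultimately show ?case
      using insert bounded_on_insert_A_tooth[of k "I \<inter> J \<union> K"]
        bounded_on_insert_B_tooth[of k "I \<inter> J \<union> K"]
      by (cases "k \<in> I \<inter> J") (auto simp: insert_absorb)
  qed (simp add: bounded_on_common_teeth)
  moreover have "I \<inter> J \<union> - {z, c} = - {z, c}" using A.I_subset by blast
  ultimately show ?thesis by (metis order_refl)
qed

end

section \<open>Stable pairs with a common unit vector are combs\<close>

lemma ex_last_multiple:
  fixes A :: "(real ^ 'n) set"
  assumes fin: "finite A" and "0 \<in> A" and down: "down_set A"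
  obtains m where "\<And>n. real n *\<^sub>R unit c \<in> A \<longleftrightarrow> n \<le> m" "m < card A"
proof -
  let ?u = "\<lambda>n. real n *\<^sub>R unit c :: real ^ 'n"
  let ?N = "{n. ?u n \<in> A}"
  have finite_N: "finite ?N" using finite_vimageI[OF fin inj_scaled_unit] by (simp add: vimage_def)
  define m where "m = Max ?N"
  have "?N \<noteq> {}" using assms(2) by (auto intro: exI[of _ 0])
  then have "m \<in> ?N" unfolding m_def by (rule Max_in[OF finite_N])
  then have "?u m \<in> A" by simp
  then have mem: "?u n \<in> A" if "n \<le> m" for n
    by (rule down_setD[OF down]) (use that in \<open>auto simp: unit_nth\<close>)
  have index_le: "n \<le> m" if "?u n \<in> A" for n unfolding m_def using finite_N that by simp
  have "card (?u ` {..m}) = m + 1"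
    using inj_scaled_unit by (subst card_image) (auto intro: inj_on_subset)
  moreover have "card (?u ` {..m}) \<le> card A" using fin mem by (intro card_mono) auto
  ultimately have "m < card A" by simp
  then show thesis using mem index_le by (intro that[of m]) auto
qed

context
  fixes z c :: "'n::finite" and A :: "(real ^ 'n) set" and m :: nat
  assumes down: "down_set A" and fin: "finite A" and z_neq_c: "z \<noteq> c"
    and unit_c_mem: "unit c \<in> A" and multiple_iff: "\<And>n. real n *\<^sub>R unit c \<in> A \<longleftrightarrow> n \<le> m"
    and exchange: "\<And>k. k \<noteq> z \<Longrightarrow> k \<noteq> c \<Longrightarrow> unit k \<in> A \<Longrightarrow> exchange_closed k c m A"
begin

lemma exchange_unit:
  assumes "k \<noteq> z" "k \<noteq> c" "unit k + x \<in> A" "x \<in> nat_vectors"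
  shows "x + real m *\<^sub>R unit c \<in> A"
proof -
  have "unit k \<in> A"
    using assms(4) nat_vectors_nonneg by (intro down_setD[OF down assms(3)]) auto
  moreover have "(unit k + x) $ k \<ge> 1" using nat_vectors_nonneg[OF assms(4), of k] by simp
  ultimately have "unit k + x - unit k + real m *\<^sub>R unit c \<in> A"
    using exchange[OF assms(1,2)] assms(3) unfolding exchange_closed_def by blast
  then show ?thesis by simp
qed

lemma unit_plus_unit_notin:
  assumes k_tooth: "k \<noteq> z" "k \<noteq> c" and j_neq_z: "j \<noteq> z"
  shows "unit k + unit j \<notin> A"
proof
  have "unit c + real m *\<^sub>R unit c = real (Suc m) *\<^sub>R unit c" by (simp add: algebra_simps)
  then have last: "unit c + real m *\<^sub>R unit c \<notin> A" using multiple_iff[of "Suc m"] by simp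
  assume "unit k + unit j \<in> A"
  then have mem: "unit j + real m *\<^sub>R unit c \<in> A" using k_tooth by (intro exchange_unit) auto
  then have "j \<noteq> c" using last by blast
  have "m \<ge> 1" using multiple_iff[of 1] unit_c_mem by simp
  then have "unit j + unit c \<in> A"
    by (intro down_setD[OF down mem]) (auto simp: unit_nth)
  then have "unit c + real m *\<^sub>R unit c \<in> A" using j_neq_z \<open>j \<noteq> c\<close> by (intro exchange_unit) auto
  then show False using last by blast
qed

lemma orth_proj_mem_comb_base:
  assumes x_mem: "x \<in> A"
  shows "orth_proj (unit z) x \<in> comb_base c m {k. k \<noteq> z \<and> k \<noteq> c \<and> unit k \<in> A}"
proof (cases "\<forall>k. k \<noteq> z \<longrightarrow> k \<noteq> c \<longrightarrow> x $ k = 0")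
  case True
  have nat: "x \<in> nat_vectors" using down_set_nat_vectors[OF down x_mem] .
  then obtain n where n: "x $ c = real n" using nat_vectors_nth Nats_cases by metis
  have "real n *\<^sub>R unit c \<in> A"
    using n nat_vectors_nonneg[OF nat] by (intro down_setD[OF down x_mem]) (auto simp: unit_nth)
  moreover have "orth_proj (unit z) x = real n *\<^sub>R unit c"
    using True n z_neq_c by (auto simp: orth_proj_unit vec_eq_iff unit_nth)
  ultimately show ?thesis using multiple_iff by (auto simp: comb_base_def)
next
  case False
  then obtain k where k: "k \<noteq> z" "k \<noteq> c" "x $ k \<noteq> 0" by blast
  have nat: "x \<in> nat_vectors" using down_set_nat_vectors[OF down x_mem] .
  have "x $ j = unit k $ j" if "j \<noteq> z" for j
  proof (rule ccontr)
    assume "x $ j \<noteq> unit k $ j"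
    then have "unit k $ j < x $ j"
      using nat_vectors_ge_one[OF nat k(3)] nat_vectors_nonneg[OF nat, of j] by (cases "j = k") auto
    then have "unit k $ j + 1 \<le> x $ j" using nat by (simp add: nat_vectors_less_iff)
    then have "unit k + unit j \<in> A"
      using nat_vectors_nonneg[OF nat] nat_vectors_ge_one[OF nat k(3)]
      by (intro down_setD[OF down x_mem]) (auto simp: unit_nth)
    then show False using unit_plus_unit_notin k that by blast
  qed
  then have "orth_proj (unit z) x = unit k"
    using k(1) by (auto simp: orth_proj_unit vec_eq_iff unit_nth)
  moreover have "unit k \<in> A" using unit_mem_down_set[OF down x_mem k(3)] .
  ultimately show ?thesis using k by (auto simp: comb_base_def)
qed

lemma comb_if_exchange_closed: "comb z c A m {k. k \<noteq> z \<and> k \<noteq> c \<and> unit k \<in> A}"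
proof -
  let ?I = "{k. k \<noteq> z \<and> k \<noteq> c \<and> unit k \<in> A}"
  interpret axis_compression z by (rule axis_compression)

  have "u = base u" "u \<in> A" if "u \<in> comb_base c m ?I" for u
    using that multiple_iff z_neq_c base_unit
    by (auto simp: comb_base_def)
  then have "base ` A = comb_base c m ?I"
    using orth_proj_mem_comb_base unfolding base_eq_orth_proj by blast
  then show ?thesis using fin z_neq_c by unfold_locales auto
qed

end

lemma ex_exchange_closed_lattice_pair:
  fixes A0 B0 :: "(real ^ 'n) set"
  assumes initial: "lattice_pair z {c} A0 B0" and z_neq_c: "z \<noteq> c"
  obtains A B where "reduces_to (unit z) A0 B0 (unit z) A B" "lattice_pair z {c} A B"
    "down_set A" "down_set B"
    "\<And>k n. k \<noteq> z \<Longrightarrow> k \<noteq> c \<Longrightarrow> n \<le> card A + card B \<Longrightarrow>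
      unit k \<in> A \<and> real n *\<^sub>R unit c \<in> A \<or> unit k \<in> B \<and> real n *\<^sub>R unit c \<in> B \<Longrightarrow>
      exchange_closed k c n A \<and> exchange_closed k c n B"
proof -
  \<comment> \<open>every other unit vector outweighs all multiples of \<open>unit c\<close> that occur in the sets\<close>
  define weight where
    "weight i = (if i = z then 0 else if i = c then 1 else card A0 + card B0 + 1)" for i
  have weight_pos: "weight i > 0" if "i \<noteq> z" for i using that by (simp add: weight_def)
  obtain A B where red: "reduces_to (unit z) A0 B0 (unit z) A B" and pair: "lattice_pair z {c} A B"
    and down: "down_set A" "down_set B"
    and stable: "\<And>k e n. k \<noteq> z \<Longrightarrow> k \<notin> {c} \<Longrightarrow> e \<noteq> z \<Longrightarrow> e \<noteq> k \<Longrightarrow> n * weight e < weight k \<Longrightarrow>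
      unit k \<in> A \<and> real n *\<^sub>R unit e \<in> A \<or> unit k \<in> B \<and> real n *\<^sub>R unit e \<in> B \<Longrightarrow>
      exchange_closed k e n A \<and> exchange_closed k e n B"
    by (rule ex_stable_lattice_pair[OF initial, of weight]) (use weight_pos in blast)+
  have "exchange_closed k c n A \<and> exchange_closed k c n B"
    if "k \<noteq> z" "k \<noteq> c" "n \<le> card A + card B"
      "unit k \<in> A \<and> real n *\<^sub>R unit c \<in> A \<or> unit k \<in> B \<and> real n *\<^sub>R unit c \<in> B" for k n
    using that z_neq_c red by (intro stable) (auto simp: weight_def reduces_to_def)
  then show thesis using red pair down by (intro that[of A B]) auto
qed

lemma ex_comb_pair:
  fixes A0 B0 :: "(real ^ 'n) set"
  assumes initial: "lattice_pair z {c} A0 B0" and z_neq_c: "z \<noteq> c"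
  obtains A B p I q J where "reduces_to (unit z) A0 B0 (unit z) A B" "lattice_pair z {c} A B"
    "down_set B" "comb_pair z c A p I B q J"
proof -
  obtain A B where red: "reduces_to (unit z) A0 B0 (unit z) A B" and pair: "lattice_pair z {c} A B"
    and down: "down_set A" "down_set B"
    and exchange: "\<And>k n. k \<noteq> z \<Longrightarrow> k \<noteq> c \<Longrightarrow> n \<le> card A + card B \<Longrightarrow>
      unit k \<in> A \<and> real n *\<^sub>R unit c \<in> A \<or> unit k \<in> B \<and> real n *\<^sub>R unit c \<in> B \<Longrightarrow>
      exchange_closed k c n A \<and> exchange_closed k c n B"
    by (rule ex_exchange_closed_lattice_pair[OF initial z_neq_c]) blast
  have fin: "finite A" "finite B" using lattice_pair_finite[OF pair] by auto
  have mem: "0 \<in> A" "0 \<in> B" "unit c \<in> A" "unit c \<in> B" using pair by (auto simp: lattice_pair_def)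
  obtain p where p: "\<And>n. real n *\<^sub>R unit c \<in> A \<longleftrightarrow> n \<le> p" "p < card A"
    using ex_last_multiple[OF fin(1) mem(1) down(1), of c] by blast
  obtain q where q: "\<And>n. real n *\<^sub>R unit c \<in> B \<longleftrightarrow> n \<le> q" "q < card B"
    using ex_last_multiple[OF fin(2) mem(2) down(2), of c] by blast
  define I where "I = {k. k \<noteq> z \<and> k \<noteq> c \<and> unit k \<in> A}"
  define J where "J = {k. k \<noteq> z \<and> k \<noteq> c \<and> unit k \<in> B}"
  have comb_A: "comb z c A p I"
    unfolding I_def using down fin z_neq_c mem p exchange by (intro comb_if_exchange_closed) auto
  have comb_B: "comb z c B q J"
    unfolding J_def using down fin z_neq_c mem q exchange by (intro comb_if_exchange_closed) auto
  have "p = q" if common: "I \<inter> J \<noteq> {}"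
  proof -
    obtain k where k: "k \<noteq> z" "k \<noteq> c" "unit k \<in> A" "unit k \<in> B"
      using common by (auto simp: I_def J_def)
    have "exchange_closed k c p B" "exchange_closed k c q A" using exchange[OF k(1,2)] k p q by auto
    then have "real p *\<^sub>R unit c \<in> B" "real q *\<^sub>R unit c \<in> A"
      using k unfolding exchange_closed_def by fastforce+
    then show ?thesis using p(1) q(1) by simp
  qed
  moreover have "I \<union> J = - {z, c}" using pair by (auto simp: I_def J_def lattice_pair_def)
  ultimately have "comb_pair z c A p I B q J"
    using comb_A comb_B axis_compression by (simp add: comb_pair_def comb_pair_axioms_def)
  then show thesis using red pair down by (intro that) auto
qed

lemma lattice_pair_cases:
  fixes A0 B0 :: "(real ^ 'n) set"
  assumes "lattice_pair z {} A0 B0"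
  obtains (combs) A B c p I q J where "reduces_to (unit z) A0 B0 (unit z) A B"
      "lattice_pair z {c} A B" "down_set B" "comb_pair z c A p I B q J"
    | (disjoint) A B where "reduces_to (unit z) A0 B0 (unit z) A B" "lattice_pair z {} A B"
      "down_set A" "down_set B" "\<And>i. i \<noteq> z \<Longrightarrow> unit i \<notin> A \<inter> B"
proof -
  obtain A B where red: "reduces_to (unit z) A0 B0 (unit z) A B" and pair: "lattice_pair z {} A B"
    and down: "down_set A" "down_set B"
    using ex_stable_lattice_pair[OF assms, of "\<lambda>_. 1"] by (metis zero_less_one)
  show thesis
  proof (cases "\<exists>c. c \<noteq> z \<and> unit c \<in> A \<inter> B")
    case True
    then obtain c where "c \<noteq> z" "unit c \<in> A \<inter> B" by blast
    moreover from this have "lattice_pair z {c} A B" using pair by (simp add: lattice_pair_def)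
    ultimately show ?thesis
      using ex_comb_pair[of z c A B] combs reduces_to_trans[OF red] by metis
  next
    case False
    then show ?thesis using disjoint red pair down by blast
  qed
qed

section \<open>The bound for reduced pairs\<close>

context comb_pair
begin

lemma card_teeth: "card (I \<union> J) + 2 = CARD('n)"
  using card_mono[of UNIV "{z, c}"] A.z_neq_c
  by (simp add: cover Compl_eq_Diff_UNIV card_Diff_subset)

lemma comb_weights_sum:
  "comb_weight p q I J (- {z, c}) + comb_weight q p J I (- {z, c})
    = (real p + real q + 1) / (real p + 1) + (real p + real q + 1) / (real q + 1)
      + (real CARD('n) - 2)"
proof -
  have "- {z, c} \<inter> J = J" "- {z, c} \<inter> I = I" using A.I_subset B.I_subset by blast+
  moreover have "card (I \<union> J) = card (J - I) + card (I - J) + card (I \<inter> J)"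
    using card_Un_disjoint[of "J - I" "I"] card_Int_Diff[of I J] by (simp add: Un_commute ac_simps)
  then have "real (card (J - I)) + real (card (I - J)) + real (card (I \<inter> J)) = real CARD('n) - 2"
    unfolding card_teeth[symmetric] by simp
  ultimately show ?thesis by (simp add: comb_weight_def Int_commute add.commute)
qed

lemma sumset_bound_combs:
  fixes e :: int
  assumes card_le: "card B \<le> card A"
    and e_bounds: "int (card J) + 2 \<le> e" "e \<le> int (line_count (unit z) B)"
    and d_le: "CARD('n) \<le> line_count (unit z) A"
  shows "sumset_bound CARD('n) e (line_count (unit z) A) (line_count (unit z) B) (card A) (card B)
    \<le> card (A + B)"
proof (rule sumset_bound_le_if_weighted_bound)
  have card: "real (card (- {z, c})) + 1 = real CARD('n) - 1" using card_teeth by (simp add: cover)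
  show "comb_weight p q I J (- {z, c}) * card A + comb_weight q p J I (- {z, c}) * card B
      - (real CARD('n) - 1) * (real (line_count (unit z) A) + real (line_count (unit z) B))
    \<le> card (A + B)"
    using bounded_on_all_teeth
    unfolding bounded_on_def card A.part_eq_self[OF A.I_subset] B.part_eq_self[OF B.I_subset] .
  show "comb_weight p q I J (- {z, c}) + comb_weight q p J I (- {z, c})
      = ((real p + 1) + (real q + 1) - 1) / (real p + 1)
        + ((real p + 1) + (real q + 1) - 1) / (real q + 1) + (real CARD('n) - 2)"
    using comb_weights_sum by (simp add: add.commute add.left_commute)
  have "card I \<le> card (I \<union> J)" by (intro card_mono) auto
  then show "real (line_count (unit z) A) - real CARD('n) + 2 \<le> real p + 1"
    using card_teeth by (simp add: A.line_count_eq)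
  show "real (line_count (unit z) B) - e + 2 \<le> real q + 1"
    using e_bounds(1) by (simp add: B.line_count_eq)
qed (use card_le e_bounds d_le comb_weight_ge_one in auto)

lemma card_teeth_le_dim_parameter:
  assumes pair: "lattice_pair z {c} A B" and down: "down_set B"
    and param: "dim_parameter (unit z) B e"
  shows "int (card J) + 2 \<le> e"
proof (cases "line_count (unit z) B < CARD('n)")
  case True
  have B_props: "0 \<in> B" "unit c \<in> B" "stacked z B" using pair by (auto simp: lattice_pair_def)
  have base_B: "base ` B = {x \<in> B. x $ z = 0}"
    using orth_proj_stacked[OF B_props(3)] by (simp add: base_eq_orth_proj)
  have "unit ` J \<subseteq> base ` B" unfolding B.base_A by (auto simp: comb_base_def)
  then have "unit ` J \<subseteq> B" unfolding base_B by blast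
  moreover have "unit z \<in> B"
  proof -
    have "card (base ` B) < card B"
      using param True
      by (simp add: dim_parameter_def line_count_eq_card_base)
    then have "{x \<in> B. x $ z = 0} \<noteq> B" using base_B by auto
    then show ?thesis using unit_mem_down_set[OF down] by blast
  qed
  ultimately have "int (card (insert z (insert c J))) \<le> aff_dim B"
    using B_props by (intro card_units_le_aff_dim) auto
  moreover have "card (insert z (insert c J)) = card J + 2"
    using A.z_neq_c B.I_subset by (subst card_insert_disjoint; auto)+
  ultimately show ?thesis using param True by (simp add: dim_parameter_def)
next
  case False
  have "card J \<le> card (I \<union> J)" by (intro card_mono) auto
  then show ?thesis using param False card_teeth by (simp add: dim_parameter_def)
qed

end

lemma sumset_bound_if_dim_parameter:
  fixes A B :: "(real ^ 'n) set"
  assumes fin: "finite A" "finite B" and v_nz: "v \<noteq> 0" and dim: "aff_dim (A + B) = int CARD('n)"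
    and d_le: "2 \<le> CARD('n)" "CARD('n) \<le> line_count v A" and card_le: "card B \<le> card A"
    and param: "dim_parameter v B c"
  shows "sumset_bound CARD('n) c (line_count v A) (line_count v B) (card A) (card B) \<le> card (A + B)"
proof -
  have bound: ?thesis if "reduces_to v A B (unit z) A' B'"
    "sumset_bound CARD('n) c (line_count (unit z) A') (line_count (unit z) B') (card A') (card B')
      \<le> card (A' + B')" for z :: 'n and A' B'
    using that by (simp add: reduces_to_def)
  obtain z :: 'n and A0 B0 where red: "reduces_to v A B (unit z) A0 B0"
    and initial: "lattice_pair z {} A0 B0"
    using ex_lattice_pair[OF fin dim v_nz] .
  show ?thesis
    using initial
  proof (cases rule: lattice_pair_cases)
    case (combs A' B' e p I q J)
    then have red': "reduces_to v A B (unit z) A' B'" using red reduces_to_trans by blast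
    then have dim': "dim_parameter (unit z) B' c" using param dim_parameter_reduces_to by fastforce
    show ?thesis
    proof (rule bound[OF red'], rule comb_pair.sumset_bound_combs[OF combs(4)])
      show "int (card J) + 2 \<le> c"
        using comb_pair.card_teeth_le_dim_parameter[OF combs(4,2,3) dim'] .
    qed (use red' dim' card_le d_le in \<open>auto simp: reduces_to_def dim_parameter_def\<close>)
  next
    case (disjoint A' B')
    then have red': "reduces_to v A B (unit z) A' B'" using red reduces_to_trans by blast
    then have dim': "dim_parameter (unit z) B' c" using param dim_parameter_reduces_to by fastforce
    have fin': "finite A'" "finite B'" "B' \<noteq> {}"
      using disjoint(2) lattice_pair_finite by (auto simp: lattice_pair_def)
    show ?thesis
    proof (rule bound[OF red'], rule sumset_bound_le_if_unique_lines)
      show "real (line_count (unit z) A') * card B' + real (line_count (unit z) B') * card A'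
          \<le> card (A' + B') + real (line_count (unit z) A') * line_count (unit z) B'"
        using card_plus_ge_if_disjoint_units[OF fin'(1,2) disjoint(3-5)]
        by (simp flip: of_nat_mult of_nat_add)
      show "line_count (unit z) A' \<le> card A'" by (rule line_count_le_card[OF fin'(1)])
      show "1 \<le> line_count (unit z) B'"
        using fin' by (simp add: line_count_def Suc_le_eq card_gt_0_iff)
      show "real_of_int c = 1" if "line_count (unit z) B' = 1"
        using dim_parameter_eq_one[OF dim' that] d_le by simp
    qed (use red' dim' card_le d_le in \<open>auto simp: reduces_to_def dim_parameter_def\<close>)
  qed
qed

theorem theorem1p4:
  fixes A B :: "(real ^ 'n) set" and v :: "real ^ 'n"
    and r\<^sub>1 r\<^sub>2 d :: nat and c :: int
  assumes "d = CARD('n)" and "r\<^sub>1 \<ge> 1" and "r\<^sub>2 \<ge> 1"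
    and "r\<^sub>1 \<ge> d" and "d \<ge> 2"
    and "finite A" and "A \<noteq> {}" and "finite B" and "B \<noteq> {}"
    and "card A \<ge> card B"
    and "aff_dim (A + B) = int d"
    and "v \<noteq> 0"
    and "card (orth_proj v ` A) = r\<^sub>1"
    and "card (orth_proj v ` B) = r\<^sub>2"
    and "c = (if r\<^sub>2 \<ge> d then int d else aff_dim B)"
  shows "real (card (A + B)) \<ge>
    real (card A)
    + (real d + 1 - 1 / (real r\<^sub>1 - real d + 2) - 1 / (real r\<^sub>2 - real_of_int c + 2)) * real (card B)
    - (real d - 1) * (real r\<^sub>1 + real r\<^sub>2)"
proof -
  have lines: "line_count v A = r\<^sub>1" "line_count v B = r\<^sub>2"
    using assms by (simp_all add: line_count_def)
  have c_le: "c \<le> int r\<^sub>2" using assms lines aff_dim_le_line_count[of B v] by auto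
  have "sumset_bound d c r\<^sub>1 r\<^sub>2 (card A) (card B) \<le> card (A + B)"
  proof (cases "r\<^sub>2 < d \<and> card B = r\<^sub>2")
    case True
    then have "sumset_bound d c r\<^sub>1 r\<^sub>2 (card A) (card B) \<le> card A"
      using assms c_le by (auto intro!: sumset_bound_le_left)
    also have "\<dots> \<le> card (A + B)" using assms card_le_card_plus by simp
    finally show ?thesis .
  next
    case False
    moreover have "r\<^sub>2 \<le> card B" using line_count_le_card[of B v] assms lines by simp
    ultimately have "dim_parameter v B c" using assms lines c_le by (auto simp: dim_parameter_def)
    then show ?thesis using sumset_bound_if_dim_parameter[of A B v c] assms lines by simp
  qed
  then show ?thesis by (simp add: sumset_bound_def)
qed

end
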